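(* Let $G$ be a finite graph and $k\in\mathbb N$. Then there exists a tree-decomposition $(T,\mathcal V)$ of $G$ of adhesion $<k$ with the following properties: (i) $(T,\mathcal V)$ efficiently distinguishes all regular $k$-profiles in $G$; (ii) each part of $(T,\mathcal V)$ of size $>3k-3$ is home to a $k$-tangle, which it then witnesses and induces; (iii) every separable $k$-block in $G$ appears as a part of $(T,\mathcal V)$.
   Context: A separation of $G=(V,E)$ is $\{A,B\}$ with $A\cup B=V$ and every edge in $G[A]$ or $G[B]$; orientations $(A,B),(B,A)$ (mutually inverse, inverse of $\vec s$ written $\overleftarrow s$); order $|A\cap B|$; $(A,B)\le(C,D)$ iff $A\subseteq C$, $D\subseteq B$; $(A,B)\vee(C,D)=(A\cup C,B\cap D)$. $S_k(G)$: separations of order $<k$, $\vec S_k(G)$ their orientations. $\vec s$ is small if $\vec s\le\overleftarrow s$, co-small if $\overleftarrow s$ is small, degenerate if $\vec s=\overleftarrow s$. A star is a set of non-degenerate oriented separations with $\vec r\le\overleftarrow s$ for all distinct elements; its interior is $\bigcap_{(A,B)\in\sigma}B$. An orientation of $S_k(G)$ contains every degenerate separation and exactly one orientation of each non-degenerate one; consistent if there are no distinct $r,s$ with $\vec r<\vec s$ and $\overleftarrow r,\vec s$ in it. A $k$-profile is a consistent orientation $P$ with $(\vec r\vee\vec s)^*\notin P$ for all $\vec r,\vec s\in P$; it is regular if it contains no co-small separation. $\mathcal T_k$ is the set of all $\{(A_1,B_1),(A_2,B_2),(A_3,B_3)\}\subseteq\vec S_k(G)$ with $G[A_1]\cup G[A_2]\cup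 G[A_3]=G$; a $k$-tangle is a consistent orientation of $S_k(G)$ containing no element of $\mathcal T_k$. A separation distinguishes two orientations if non-degenerate and oriented differently by them, efficiently if no separation of lower order does. For a tree-decomposition $(T,(V_t)_{t\in T})$: its adhesion is $\max\{|V_t\cap V_{t'}|:tt'\in E(T)\}$; an oriented edge $(t_1,t_2)$ induces the separation $(\bigcup_{t\in T_1}V_t,\bigcup_{t\in T_2}V_t)$, $T_i\ni t_i$ the components of $T-t_1t_2$; it efficiently distinguishes a set of orientations if any two distinct ones are efficiently distinguished by a separation induced by an edge. The star associated with $V_t$ is $\sigma_t=\{$separation induced by $(u,t)$: $ut\in E(T)\}$; $V_t$ is home to an orientation $O$ if $\sigma_t\subseteq O$. A subgraph $H$ witnesses a $k$-tangle $\tau$ if for every set $\{(A_i,B_i):i\in[3]\}\subseteq\tau$ of at most three elements, $\bigcup_{i}G[A_i\cap V(H)]\ne H$. A vertex set $U$ induces a $k$-profile $\tau$ if $|A\cap U|<|B\cap U|$ for every $(A,B)\in\tau$. A $k$-block is a maximal set $b$ of at least $k$ vertices such that no two vertices of $b$ can be separated in $G$ by fewer than $k$ vertices; it is separable if $b=\mathrm{interior}(\sigma)$ for some star $\sigma\subseteq\vec S_k(G)$. *)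

theory Defs
  imports "Graph_Theory.Graph_Theory"
begin

text \<open>
  Finite simple graphs are the symmetric, loop-free digraphs without parallel arcs of the locale
  \<^locale>\<open>graph\<close>; an undirected edge is a pair of opposite arcs, and \<open>G \<restriction> A\<close> is the induced
  subgraph \<open>G[A]\<close>.
\<close>

section \<open>Separations\<close>

text \<open>
  A pair \<open>(A, B)\<close> is an oriented separation, and \<^const>\<open>prod.swap\<close> maps it to its inverse. The
  unoriented separation \<open>{A, B}\<close> is represented by either of its orientations, so two separations
  \<open>r\<close>, \<open>s\<close> are distinct as unoriented separations iff \<open>r \<noteq> s\<close> and \<open>r \<noteq> prod.swap s\<close>.
\<close>

type_synonym 'a separation = "'a set \<times> 'a set"

definition separations :: "('a, 'b) pre_digraph \<Rightarrow> 'a separation set" where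
  "separations G =
     {(A, B). A \<union> B = verts G \<and> arcs G \<subseteq> arcs (G \<restriction> A) \<union> arcs (G \<restriction> B)}"

definition sep_order :: "'a separation \<Rightarrow> nat" where
  "sep_order s = card (fst s \<inter> snd s)"

definition separations_below :: "('a, 'b) pre_digraph \<Rightarrow> nat \<Rightarrow> 'a separation set" where
  "separations_below G k = {s \<in> separations G. sep_order s < k}"

definition sep_le :: "'a separation \<Rightarrow> 'a separation \<Rightarrow> bool" where
  "sep_le r s \<longleftrightarrow> fst r \<subseteq> fst s \<and> snd s \<subseteq> snd r"

definition sep_less :: "'a separation \<Rightarrow> 'a separation \<Rightarrow> bool" where
  "sep_less r s \<longleftrightarrow> sep_le r s \<and> r \<noteq> s"

definition sep_join :: "'a separation \<Rightarrow> 'a separation \<Rightarrow> 'a separation" where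
  "sep_join r s = (fst r \<union> fst s, snd r \<inter> snd s)"

definition small :: "'a separation \<Rightarrow> bool" where
  "small s \<longleftrightarrow> sep_le s (prod.swap s)"

definition co_small :: "'a separation \<Rightarrow> bool" where
  "co_small s \<longleftrightarrow> small (prod.swap s)"

definition degenerate :: "'a separation \<Rightarrow> bool" where
  "degenerate s \<longleftrightarrow> s = prod.swap s"

definition sep_star :: "('a, 'b) pre_digraph \<Rightarrow> 'a separation set \<Rightarrow> bool" where
  "sep_star G \<sigma> \<longleftrightarrow>
     \<sigma> \<subseteq> separations G \<and> (\<forall>s\<in>\<sigma>. \<not> degenerate s) \<and>
     (\<forall>r\<in>\<sigma>. \<forall>s\<in>\<sigma>. r \<noteq> s \<longrightarrow> sep_le r (prod.swap s))"

text \<open>The interior of the empty star is the whole vertex set.\<close>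

definition star_interior :: "('a, 'b) pre_digraph \<Rightarrow> 'a separation set \<Rightarrow> 'a set" where
  "star_interior G \<sigma> = verts G \<inter> (\<Inter>s\<in>\<sigma>. snd s)"

section \<open>Orientations, profiles and tangles\<close>

definition orientation :: "('a, 'b) pre_digraph \<Rightarrow> nat \<Rightarrow> 'a separation set \<Rightarrow> bool" where
  "orientation G k P \<longleftrightarrow>
     P \<subseteq> separations_below G k \<and>
     (\<forall>s\<in>separations_below G k. degenerate s \<longrightarrow> s \<in> P) \<and>
     (\<forall>s\<in>separations_below G k. \<not> degenerate s \<longrightarrow> (s \<in> P \<longleftrightarrow> prod.swap s \<notin> P))"

definition consistent :: "'a separation set \<Rightarrow> bool" where
  "consistent P \<longleftrightarrow>
     \<not> (\<exists>r s. r \<noteq> s \<and> r \<noteq> prod.swap s \<and> sep_less r s \<and> prod.swap r \<in> P \<and> s \<in> P)"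

definition profile :: "('a, 'b) pre_digraph \<Rightarrow> nat \<Rightarrow> 'a separation set \<Rightarrow> bool" where
  "profile G k P \<longleftrightarrow>
     orientation G k P \<and> consistent P \<and>
     (\<forall>r\<in>P. \<forall>s\<in>P. prod.swap (sep_join r s) \<notin> P)"

definition regular :: "'a separation set \<Rightarrow> bool" where
  "regular P \<longleftrightarrow> (\<forall>s\<in>P. \<not> co_small s)"

definition induced_union3 ::
  "('a, 'b) pre_digraph \<Rightarrow> 'a set \<Rightarrow> 'a set \<Rightarrow> 'a set \<Rightarrow> ('a, 'b) pre_digraph" where
  "induced_union3 G A1 A2 A3 =
     Digraph_Component.union (Digraph_Component.union (G \<restriction> A1) (G \<restriction> A2)) (G \<restriction> A3)"

definition tangle_triples :: "('a, 'b) pre_digraph \<Rightarrow> nat \<Rightarrow> 'a separation set set" where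
  "tangle_triples G k =
     {{(A1, B1), (A2, B2), (A3, B3)} | A1 B1 A2 B2 A3 B3.
        {(A1, B1), (A2, B2), (A3, B3)} \<subseteq> separations_below G k \<and>
        induced_union3 G A1 A2 A3 = G}"

definition tangle :: "('a, 'b) pre_digraph \<Rightarrow> nat \<Rightarrow> 'a separation set \<Rightarrow> bool" where
  "tangle G k \<tau> \<longleftrightarrow>
     orientation G k \<tau> \<and> consistent \<tau> \<and> (\<forall>\<sigma>\<in>tangle_triples G k. \<not> \<sigma> \<subseteq> \<tau>)"

definition distinguishes :: "'a separation \<Rightarrow> 'a separation set \<Rightarrow> 'a separation set \<Rightarrow> bool" where
  "distinguishes s P Q \<longleftrightarrow>
     \<not> degenerate s \<and> (s \<in> P \<and> prod.swap s \<in> Q \<or> prod.swap s \<in> P \<and> s \<in> Q)"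

definition efficiently_distinguishes ::
  "'a separation \<Rightarrow> 'a separation set \<Rightarrow> 'a separation set \<Rightarrow> bool" where
  "efficiently_distinguishes s P Q \<longleftrightarrow>
     distinguishes s P Q \<and> \<not> (\<exists>r. distinguishes r P Q \<and> sep_order r < sep_order s)"

definition witnesses ::
  "('a, 'b) pre_digraph \<Rightarrow> ('a, 'b) pre_digraph \<Rightarrow> 'a separation set \<Rightarrow> bool" where
  "witnesses G H \<tau> \<longleftrightarrow>
     subgraph H G \<and>
     (\<forall>A1 B1 A2 B2 A3 B3. {(A1, B1), (A2, B2), (A3, B3)} \<subseteq> \<tau> \<longrightarrow>
        induced_union3 G (A1 \<inter> verts H) (A2 \<inter> verts H) (A3 \<inter> verts H) \<noteq> H)"

definition induces :: "('a, 'b) pre_digraph \<Rightarrow> 'a set \<Rightarrow> 'a separation set \<Rightarrow> bool" where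
  "induces G U \<tau> \<longleftrightarrow>
     U \<subseteq> verts G \<and> (\<forall>(A, B)\<in>\<tau>. card (A \<inter> U) < card (B \<inter> U))"

section \<open>Blocks\<close>

definition separates :: "('a, 'b) pre_digraph \<Rightarrow> 'a set \<Rightarrow> 'a \<Rightarrow> 'a \<Rightarrow> bool" where
  "separates G X u v \<longleftrightarrow>
     u \<in> verts G - X \<and> v \<in> verts G - X \<and> \<not> u \<rightarrow>\<^sup>*\<^bsub>G \<restriction> (verts G - X)\<^esub> v"

definition inseparable :: "('a, 'b) pre_digraph \<Rightarrow> nat \<Rightarrow> 'a set \<Rightarrow> bool" where
  "inseparable G k b \<longleftrightarrow>
     (\<forall>u\<in>b. \<forall>v\<in>b. \<not> (\<exists>X. X \<subseteq> verts G \<and> card X < k \<and> separates G X u v))"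

definition block :: "('a, 'b) pre_digraph \<Rightarrow> nat \<Rightarrow> 'a set \<Rightarrow> bool" where
  "block G k b \<longleftrightarrow>
     b \<subseteq> verts G \<and> card b \<ge> k \<and> inseparable G k b \<and>
     \<not> (\<exists>b'. b \<subset> b' \<and> b' \<subseteq> verts G \<and> card b' \<ge> k \<and> inseparable G k b')"

definition separable_block :: "('a, 'b) pre_digraph \<Rightarrow> nat \<Rightarrow> 'a set \<Rightarrow> bool" where
  "separable_block G k b \<longleftrightarrow>
     block G k b \<and>
     (\<exists>\<sigma>. sep_star G \<sigma> \<and> \<sigma> \<subseteq> separations_below G k \<and> b = star_interior G \<sigma>)"

section \<open>Tree-decompositions\<close>

text \<open>
  \<^const>\<open>tree\<close> is useless for symmetric digraphs, since walking an edge back and forth counts as a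
  \<^const>\<open>pre_digraph.cycle\<close>; the cycles of an undirected graph are those of length at least 3.
  Trees are finite and, as \<^const>\<open>connected\<close> requires, nonempty.
\<close>

definition undirected_tree :: "('t, 'e) pre_digraph \<Rightarrow> bool" where
  "undirected_tree T \<longleftrightarrow>
     graph T \<and> connected T \<and> \<not> (\<exists>p. pre_digraph.cycle T p \<and> length p \<ge> 3)"

definition tree_decomposition ::
  "('a, 'b) pre_digraph \<Rightarrow> ('t, 'e) pre_digraph \<Rightarrow> ('t \<Rightarrow> 'a set) \<Rightarrow> bool" where
  "tree_decomposition G T V \<longleftrightarrow>
     undirected_tree T \<and>
     (\<Union>t\<in>verts T. V t) = verts G \<and>
     (\<forall>e\<in>arcs G. \<exists>t\<in>verts T. e \<in> arcs (G \<restriction> V t)) \<and>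
     (\<forall>t1 t2 t3 p. pre_digraph.apath T t1 p t3 \<and> t2 \<in> set (pre_digraph.awalk_verts T t1 p) \<longrightarrow>
        V t1 \<inter> V t3 \<subseteq> V t2)"

text \<open>
  The value \<open>-1\<close> stands for the maximum of the empty set: if \<open>T\<close> has no edges, then the adhesion is
  less than \<open>k\<close> for every natural number \<open>k\<close>, including \<open>0\<close>.
\<close>

definition adhesion :: "('t, 'e) pre_digraph \<Rightarrow> ('t \<Rightarrow> 'a set) \<Rightarrow> int" where
  "adhesion T V = Max (insert (-1) {int (card (V t \<inter> V t')) | t t'. t \<rightarrow>\<^bsub>T\<^esub> t'})"

definition delete_edge :: "('t, 'e) pre_digraph \<Rightarrow> 't \<Rightarrow> 't \<Rightarrow> ('t, 'e) pre_digraph" where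
  "delete_edge T t1 t2 = T\<lparr>arcs := {e \<in> arcs T. {tail T e, head T e} \<noteq> {t1, t2}}\<rparr>"

definition edge_separation ::
  "('t, 'e) pre_digraph \<Rightarrow> ('t \<Rightarrow> 'a set) \<Rightarrow> 't \<Rightarrow> 't \<Rightarrow> 'a separation" where
  "edge_separation T V t1 t2 =
     (\<Union>t\<in>{t. t1 \<rightarrow>\<^sup>*\<^bsub>delete_edge T t1 t2\<^esub> t}. V t,
      \<Union>t\<in>{t. t2 \<rightarrow>\<^sup>*\<^bsub>delete_edge T t1 t2\<^esub> t}. V t)"

definition td_efficiently_distinguishes ::
  "('t, 'e) pre_digraph \<Rightarrow> ('t \<Rightarrow> 'a set) \<Rightarrow> 'a separation set set \<Rightarrow> bool" where
  "td_efficiently_distinguishes T V \<P> \<longleftrightarrow>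
     (\<forall>P\<in>\<P>. \<forall>Q\<in>\<P>. P \<noteq> Q \<longrightarrow>
        (\<exists>t1 t2. t1 \<rightarrow>\<^bsub>T\<^esub> t2 \<and> efficiently_distinguishes (edge_separation T V t1 t2) P Q))"

definition part_star ::
  "('t, 'e) pre_digraph \<Rightarrow> ('t \<Rightarrow> 'a set) \<Rightarrow> 't \<Rightarrow> 'a separation set" where
  "part_star T V t = {edge_separation T V u t | u. u \<rightarrow>\<^bsub>T\<^esub> t}"

definition home ::
  "('t, 'e) pre_digraph \<Rightarrow> ('t \<Rightarrow> 'a set) \<Rightarrow> 't \<Rightarrow> 'a separation set \<Rightarrow> bool" where
  "home T V t P \<longleftrightarrow> part_star T V t \<subseteq> P"

end

theory Submission
  imports Defs
begin

text \<open>
  A decomposition is built up by splitting a tree along a separation \<open>(A, B)\<close>: take one copy of the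
  tree restricted to \<open>A\<close>, one restricted to \<open>B\<close>, join their roots by a new edge inducing \<open>(B, A)\<close>,
  and add a vertex of \<open>A \<inter> B\<close> to every part between the root and the parts that contain it. An edge
  \<open>(C, D)\<close> directed to the root becomes the pair \<open>(A \<inter> C, B \<union> D)\<close>, \<open>(B \<inter> C, A \<union> D)\<close>. If \<open>(A, B)\<close> is
  taken from a class of separations of order at most \<open>l\<close> that is closed under the corners
  \<open>(A \<union> C, B \<inter> D)\<close> of order at most \<open>l\<close>, and crosses as few edges as possible, then by submodularity
  both halves of a crossed edge have smaller order than the edge itself. Such a split neither
  increases the adhesion nor destroys efficient distinguishers of regular profiles.

  Applied, order by order, to the distinguishers of two profiles that live at the root, this gives a
  tree of adhesion \<open>< k\<close> that efficiently distinguishes all regular \<open>k\<close>-profiles. Among all such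
  trees take one minimising the sum of \<open>3 ^ card X\<close> over the parts \<open>X\<close> with \<open>card X \<ge> k\<close>. If a
  separation of order \<open>l < k\<close> had more than \<open>l\<close> vertices of such a part \<open>X\<close> on both sides, then
  splitting at \<open>X\<close> would decrease this sum. Hence every part with at least \<open>k\<close> vertices is lean: a separation of
  order \<open>l < k\<close> has a side with at most \<open>l\<close> vertices of the part. For parts with more than \<open>3k - 3\<close>
  vertices these small sides form the tangle. If the part \<open>X\<close> contains a \<open>k\<close>-block that is the
  interior of a star, then the separator of each star element lies in the block, so leanness forces
  \<open>A \<inter> X = A \<inter> B\<close> for each star element \<open>(A, B)\<close>, that is, \<open>X\<close> is the block.
\<close>

section \<open>Trees of parts\<close>

text \<open>
  \<open>Attach a b\<close> joins the roots of \<open>a\<close> and \<open>b\<close> by an edge and keeps the root of \<open>a\<close>. Edge separations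
  \<open>(C, D)\<close> are directed to the root, so \<open>C\<close> is the union of the parts below the edge.
\<close>

datatype 'a part_tree = Single "'a set" | Attach "'a part_tree" "'a part_tree"

primrec verts_of :: "'a part_tree \<Rightarrow> 'a set" where
  "verts_of (Single X) = X"
| "verts_of (Attach a b) = verts_of a \<union> verts_of b"

primrec root_part :: "'a part_tree \<Rightarrow> 'a set" where
  "root_part (Single X) = X"
| "root_part (Attach a b) = root_part a"

primrec parts :: "'a part_tree \<Rightarrow> 'a set set" where
  "parts (Single X) = {X}"
| "parts (Attach a b) = parts a \<union> parts b"

primrec edge_seps :: "'a part_tree \<Rightarrow> 'a separation set" where
  "edge_seps (Single X) = {}"
| "edge_seps (Attach a b) =
     (\<lambda>(C, D). (C, D \<union> verts_of b)) ` edge_seps a \<union>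
     (\<lambda>(C, D). (C, D \<union> verts_of a)) ` edge_seps b \<union> {(verts_of b, verts_of a)}"

text \<open>This is the connectivity axiom of tree-decompositions, localised at the edges: the
  separator of the joining edge is the adhesion set of its two end parts.\<close>

primrec coherent :: "'a part_tree \<Rightarrow> bool" where
  "coherent (Single X) \<longleftrightarrow> True"
| "coherent (Attach a b) \<longleftrightarrow>
     coherent a \<and> coherent b \<and> verts_of a \<inter> verts_of b \<subseteq> root_part a \<inter> root_part b"

primrec weight :: "('a set \<Rightarrow> nat) \<Rightarrow> 'a part_tree \<Rightarrow> nat" where
  "weight w (Single X) = w X"
| "weight w (Attach a b) = weight w a + weight w b"

text \<open>When a subtree is restricted, vertices from outside it enter only its root part. An
  induction over subtrees therefore bounds the other parts, and each root part is accounted for at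
  the edge above it.\<close>

primrec nonroot_weight :: "('a set \<Rightarrow> nat) \<Rightarrow> 'a part_tree \<Rightarrow> nat" where
  "nonroot_weight w (Single X) = 0"
| "nonroot_weight w (Attach a b) = nonroot_weight w a + nonroot_weight w b + w (root_part b)"

lemma weight_root: "weight w x = w (root_part x) + nonroot_weight w x"
  by (induction x) auto

lemma root_part_in_parts: "root_part x \<in> parts x"
  by (induction x) auto

lemma Union_parts: "\<Union>(parts x) = verts_of x"
  by (induction x) auto

lemma root_part_subset: "root_part x \<subseteq> verts_of x"
  by (induction x) auto

lemma finite_edge_seps: "finite (edge_seps x)"
  by (induction x) auto

lemma edge_seps_Un: "(C, D) \<in> edge_seps x \<Longrightarrow> C \<union> D = verts_of x"
  by (induction x arbitrary: C D) fastforce+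

lemma root_part_subset_edge_sep: "(C, D) \<in> edge_seps x \<Longrightarrow> root_part x \<subseteq> D"
  by (induction x arbitrary: C D) (use root_part_subset in fastforce)+

lemma edge_seps_AttachE:
  assumes "(C, D) \<in> edge_seps (Attach a b)"
  obtains (left) D' where "(C, D') \<in> edge_seps a" "D = D' \<union> verts_of b" "C \<subseteq> verts_of a"
  | (right) D' where "(C, D') \<in> edge_seps b" "D = D' \<union> verts_of a" "C \<subseteq> verts_of b"
  | (new) "C = verts_of b" "D = verts_of a"
proof -
  from assms consider D' where "(C, D') \<in> edge_seps a" "D = D' \<union> verts_of b"
    | D' where "(C, D') \<in> edge_seps b" "D = D' \<union> verts_of a" | "C = verts_of b" "D = verts_of a"
    by auto
  then show thesis
    by cases (use that edge_seps_Un in blast)+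
qed

lemma part_edge_sep: "X \<in> parts x \<Longrightarrow> (C, D) \<in> edge_seps x \<Longrightarrow> X \<subseteq> C \<or> X \<subseteq> D"
proof (induction x arbitrary: C D)
  case (Attach a b)
  have sub: "X \<in> parts a \<Longrightarrow> X \<subseteq> verts_of a" "X \<in> parts b \<Longrightarrow> X \<subseteq> verts_of b"
    using Union_parts[of a] Union_parts[of b] by auto
  have X: "X \<in> parts a \<or> X \<in> parts b" using Attach.prems(1) by simp
  show ?case using Attach.prems(2)
  proof (cases rule: edge_seps_AttachE)
    case (left D')
    show ?thesis using X
    proof
      assume "X \<in> parts a"
      from Attach.IH(1)[OF this left(1)] left(2) show ?thesis by (metis le_supI1)
    next
      assume "X \<in> parts b"
      from sub(2)[OF this] left(2) show ?thesis by (metis le_supI2)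
    qed
  next
    case (right D')
    show ?thesis using X
    proof
      assume "X \<in> parts b"
      from Attach.IH(2)[OF this right(1)] right(2) show ?thesis by (metis le_supI1)
    next
      assume "X \<in> parts a"
      from sub(1)[OF this] right(2) show ?thesis by (metis le_supI2)
    qed
  next
    case new
    with X sub show ?thesis by metis
  qed
qed simp

text \<open>As all edges are directed to one root, two of them are comparable or point towards each
  other. The fourth kind of nesting, pointing away from each other, does not arise.\<close>

lemma edge_seps_nested:
  assumes "(C, D) \<in> edge_seps x" "(C', D') \<in> edge_seps x"
  shows "C \<subseteq> C' \<and> D' \<subseteq> D \<or> C' \<subseteq> C \<and> D \<subseteq> D' \<or> C \<subseteq> D' \<and> C' \<subseteq> D"
  using assms
proof (induction x arbitrary: C D C' D')
  case (Attach a b)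
  from Attach.prems(1) show ?case
  proof (cases rule: edge_seps_AttachE)
    case l: (left E)
    from Attach.prems(2) show ?thesis
    proof (cases rule: edge_seps_AttachE)
      case (left E')
      then show ?thesis using Attach.IH(1)[OF l(1) left(1)] l by blast
    qed (use l in blast)+
  next
    case r: (right E)
    from Attach.prems(2) show ?thesis
    proof (cases rule: edge_seps_AttachE)
      case (right E')
      then show ?thesis using Attach.IH(2)[OF r(1) right(1)] r by blast
    qed (use r in blast)+
  next
    case n: new
    from Attach.prems(2) show ?thesis by (cases rule: edge_seps_AttachE) (use n in blast)+
  qed
qed simp

text \<open>The edge to \<open>b\<close> puts \<open>v\<close> into \<open>verts_of a\<close>. If
  \<open>v\<close> also lies in \<open>b\<close>, coherence puts it into the root part; if not, it
  lies on the root side of every edge inside \<open>a\<close>, and induction applies.\<close>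

lemma in_root_partI:
  assumes "coherent x" "v \<in> verts_of x" "\<And>C D. (C, D) \<in> edge_seps x \<Longrightarrow> v \<in> D"
  shows "v \<in> root_part x"
  using assms
proof (induction x)
  case (Attach a b)
  have va: "v \<in> verts_of a" using Attach.prems(3)[of "verts_of b" "verts_of a"] by simp
  show ?case
  proof (cases "v \<in> verts_of b")
    case True
    with va Attach.prems(1) show ?thesis by auto
  next
    case False
    have "v \<in> D" if "(C, D) \<in> edge_seps a" for C D
    proof -
      have "(C, D \<union> verts_of b) \<in> edge_seps (Attach a b)" using that by force
      then show ?thesis using Attach.prems(3) False by blast
    qed
    with Attach.IH(1) Attach.prems(1) va show ?thesis by simp
  qed
qed simp

subsection \<open>Changing the root\<close>

text \<open>One rooted tree is described by several terms, since the subtrees at the root can be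
  attached in any order. Equality of weights for all \<open>w\<close> expresses equality of the
  multisets of parts.\<close>

definition rooted_equiv :: "'a part_tree \<Rightarrow> 'a part_tree \<Rightarrow> bool" where
  "rooted_equiv x y \<longleftrightarrow> root_part x = root_part y \<and> edge_seps x = edge_seps y \<and> verts_of x = verts_of y \<and>
     parts x = parts y \<and> coherent x = coherent y \<and> (\<forall>w. weight w x = weight w y)"

text \<open>Moving the root reverses the edges between the old and the new root, so edges are
  compared up to inversion.\<close>

definition tree_equiv :: "'a part_tree \<Rightarrow> 'a part_tree \<Rightarrow> bool" where
  "tree_equiv x y \<longleftrightarrow>
     edge_seps x \<union> prod.swap ` edge_seps x = edge_seps y \<union> prod.swap ` edge_seps y \<and>
     verts_of x = verts_of y \<and> parts x = parts y \<and> coherent x = coherent y \<and>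
     (\<forall>w. weight w x = weight w y)"

lemma rooted_equiv_imp_tree_equiv: "rooted_equiv x y \<Longrightarrow> tree_equiv x y"
  by (auto simp: rooted_equiv_def tree_equiv_def)

lemma tree_equiv_trans: "tree_equiv x y \<Longrightarrow> tree_equiv y z \<Longrightarrow> tree_equiv x z"
  by (auto simp: tree_equiv_def)

lemma rooted_equiv_trans: "rooted_equiv x y \<Longrightarrow> rooted_equiv y z \<Longrightarrow> rooted_equiv x z"
  by (auto simp: rooted_equiv_def)

lemma tree_equiv_sym: "tree_equiv x y \<Longrightarrow> tree_equiv y x"
  by (auto simp: tree_equiv_def)

lemma rooted_equiv_Attach: "rooted_equiv x y \<Longrightarrow> rooted_equiv (Attach x c) (Attach y c)"
  by (auto simp: rooted_equiv_def)

lemma rooted_equiv_foldl: "rooted_equiv x y \<Longrightarrow> rooted_equiv (foldl Attach x cs) (foldl Attach y cs)"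
  by (induction cs arbitrary: x y) (auto intro: rooted_equiv_Attach)

text \<open>For coherence, a vertex common to \<open>b\<close> and \<open>c\<close> lies in the root
  part of \<open>a\<close>, so the condition for \<open>a\<close> and \<open>b\<close> applies to
  it.\<close>

lemma rooted_equiv_Attach_commute: "rooted_equiv (Attach (Attach a b) c) (Attach (Attach a c) b)"
proof -
  have "coherent (Attach (Attach a b) c) \<Longrightarrow> coherent (Attach (Attach a c) b)" for a b c :: "'a part_tree"
    using root_part_subset[of a] by (simp, blast)
  then have "coherent (Attach (Attach a b) c) = coherent (Attach (Attach a c) b)"
    by blast
  moreover have "edge_seps (Attach (Attach a b) c) = edge_seps (Attach (Attach a c) b)"
    by (simp add: image_Un image_image case_prod_unfold Un_ac insert_commute)
  ultimately show ?thesis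
    by (simp add: rooted_equiv_def Un_ac del: coherent.simps edge_seps.simps)
qed

lemma rooted_equiv_foldl_Attach:
  "rooted_equiv (foldl Attach (Attach a b) cs) (Attach (foldl Attach a cs) b)"
proof (induction cs arbitrary: a)
  case (Cons c cs)
  have "rooted_equiv (foldl Attach (Attach (Attach a b) c) cs) (foldl Attach (Attach (Attach a c) b) cs)"
    by (intro rooted_equiv_foldl rooted_equiv_Attach_commute)
  then show ?case using Cons[of "Attach a c"] by (auto intro: rooted_equiv_trans)
qed (simp add: rooted_equiv_def)

text \<open>The elementary change of root: it crosses the joining edge and reverses only that
  edge.\<close>

lemma tree_equiv_Attach_commute: "tree_equiv (Attach a b) (Attach b a)"
  by (auto simp: tree_equiv_def image_Un image_image case_prod_unfold)

lemma verts_of_foldl_Attach: "verts_of (foldl Attach x cs) = verts_of x \<union> \<Union>(verts_of ` set cs)"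
  by (induction cs arbitrary: x) auto

text \<open>
  \<open>cs\<close> lists the subtrees hanging at the root of \<open>x\<close> that are already known to point to it; the sink
  is found by walking down \<open>x\<close>.
\<close>

lemma exists_sink_foldl:
  assumes "edge_seps (foldl Attach x cs) \<subseteq> E"
    and "prod.swap ` E \<subseteq> E"
    and "\<forall>C D. (C, D) \<in> E \<longrightarrow> (C, D) \<in> Q \<or> (D, C) \<in> Q"
    and "\<forall>C D C' D'. (C, D) \<in> Q \<longrightarrow> (C', D') \<in> E \<longrightarrow> C' \<subseteq> C \<longrightarrow> D \<subseteq> D' \<longrightarrow> (C', D') \<in> Q"
    and "edge_seps (foldl Attach x cs) - (\<lambda>(C, D). (C, D \<union> \<Union>(verts_of ` set cs))) ` edge_seps x \<subseteq> Q"
  shows "\<exists>y. tree_equiv y (foldl Attach x cs) \<and> edge_seps y \<subseteq> Q"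
  using assms
proof (induction x arbitrary: cs)
  case (Single X)
  then show ?case by (intro exI[of _ "foldl Attach (Single X) cs"]) (simp add: tree_equiv_def)
next
  case (Attach a b)
  note E = Attach.prems(2) and tot = Attach.prems(3) and down = Attach.prems(4)
  define S where "S = \<Union>(verts_of ` set cs)"
  define z where "z = foldl Attach a cs"
  have z: "verts_of z = verts_of a \<union> S" by (simp add: z_def S_def verts_of_foldl_Attach)
  have eq: "rooted_equiv (foldl Attach (Attach a b) cs) (Attach z b)"
    unfolding z_def by (rule rooted_equiv_foldl_Attach)
  have eq2: "tree_equiv (Attach b z) (foldl Attach (Attach a b) cs)"
    by (rule tree_equiv_trans[OF tree_equiv_Attach_commute
          tree_equiv_sym[OF rooted_equiv_imp_tree_equiv[OF eq]]])
  have edges: "edge_seps (foldl Attach (Attach a b) cs) = edge_seps (Attach z b)"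
    using eq by (simp add: rooted_equiv_def)
  have bE: "(verts_of b, verts_of z) \<in> E" using Attach.prems(1) edges by auto
  show ?case
  proof (cases "(verts_of b, verts_of z) \<in> Q")
    \<comment> \<open>The edge from \<open>b\<close> points to the root, hence so do all edges
      inside \<open>b\<close>, which lie below it. Thus \<open>b\<close> joins the list of finished
      subtrees and the walk continues in \<open>a\<close>.\<close>
    case True
    have "edge_seps (foldl Attach a (b # cs)) -
      (\<lambda>(C, D). (C, D \<union> \<Union>(verts_of ` set (b # cs)))) ` edge_seps a \<subseteq> Q"
    proof
      fix e assume e: "e \<in> edge_seps (foldl Attach a (b # cs)) -
        (\<lambda>(C, D). (C, D \<union> \<Union>(verts_of ` set (b # cs)))) ` edge_seps a"
      show "e \<in> Q"
      proof (cases "e \<in> (\<lambda>(C, D). (C, D \<union> S)) ` edge_seps (Attach a b)")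
        case False
        then show ?thesis using subsetD[OF Attach.prems(5), of e] e unfolding S_def by simp
      next
        case t: True
        then obtain p where "p \<in> edge_seps (Attach a b)" "e = (case p of (C, D) \<Rightarrow> (C, D \<union> S))"
          by (rule imageE)
        then obtain C D where CD: "e = (C, D \<union> S)" "(C, D) \<in> edge_seps (Attach a b)"
          by (cases p) simp
        from CD(2) have "C \<subseteq> verts_of b \<and> verts_of z \<subseteq> D \<union> S"
        proof (cases rule: edge_seps_AttachE)
          case (left D')
          then have "e \<in> (\<lambda>(C, D). (C, D \<union> \<Union>(verts_of ` set (b # cs)))) ` edge_seps a"
            using CD(1) by (simp add: S_def Un_assoc rev_image_eqI[OF left(1)])
          with e show ?thesis by blast
        qed (auto simp: z)
        moreover have "e \<in> E" using subsetD[OF Attach.prems(1), of e] e by simp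
        ultimately show ?thesis using down True CD(1) by blast
      qed
    qed
    from Attach.IH(1)[OF _ E tot down this] Attach.prems(1) show ?thesis by simp
  next
    \<comment> \<open>The root moves to \<open>b\<close>. Everything gathered so far becomes a
      single finished subtree \<open>z\<close> hanging at \<open>b\<close>: its edges, directed to
      \<open>b\<close>, lie below the reversed joining edge, which is in \<open>Q\<close>.\<close>
    case False
    with tot bE have zQ: "(verts_of z, verts_of b) \<in> Q" by blast
    have sub: "edge_seps (Attach b z) \<subseteq> E"
    proof -
      have "edge_seps (Attach b z) \<subseteq> edge_seps (foldl Attach (Attach a b) cs) \<union>
          prod.swap ` edge_seps (foldl Attach (Attach a b) cs)"
        using eq2 unfolding tree_equiv_def by (metis Un_upper1)
      also have "\<dots> \<subseteq> E" using image_mono[OF Attach.prems(1), of prod.swap] Attach.prems(1) E by simp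
      finally show ?thesis .
    qed
    have "edge_seps (foldl Attach b [z]) - (\<lambda>(C, D). (C, D \<union> \<Union>(verts_of ` set [z]))) ` edge_seps b \<subseteq> Q"
    proof
      fix e assume e: "e \<in> edge_seps (foldl Attach b [z]) -
        (\<lambda>(C, D). (C, D \<union> \<Union>(verts_of ` set [z]))) ` edge_seps b"
      obtain C D where CD: "e = (C, D)" by fastforce
      have "(C, D) \<in> edge_seps (Attach b z)" using e CD by (simp del: edge_seps.simps)
      then have "C \<subseteq> verts_of z \<and> verts_of b \<subseteq> D"
      proof (cases rule: edge_seps_AttachE)
        case (left D')
        then have "e \<in> (\<lambda>(C, D). (C, D \<union> \<Union>(verts_of ` set [z]))) ` edge_seps b"
          using CD by (simp add: rev_image_eqI[OF left(1)])
        with e show ?thesis by blast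
      qed auto
      moreover have "(C, D) \<in> E" using subsetD[OF sub] e CD by (simp del: edge_seps.simps)
      ultimately show "e \<in> Q" using down zQ CD by blast
    qed
    from Attach.IH(2)[OF _ E tot down this] sub
    obtain y where "tree_equiv y (Attach b z)" "edge_seps y \<subseteq> Q" by auto
    then show ?thesis using eq2 tree_equiv_trans by blast
  qed
qed

text \<open>Every orientation of the edges of a finite tree has a sink, and the tree is rooted
  there. \<open>Q\<close> may contain both orientations of an edge; it will be a profile, or the set
  of separations with a given part or block on their second side.\<close>

lemma exists_sink:
  assumes "\<And>C D. (C, D) \<in> edge_seps x \<Longrightarrow> (C, D) \<in> Q \<or> (D, C) \<in> Q"
    and "\<And>C D C' D'. (C, D) \<in> Q \<Longrightarrow> (C', D') \<in> edge_seps x \<union> prod.swap ` edge_seps x \<Longrightarrow>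
      C' \<subseteq> C \<Longrightarrow> D \<subseteq> D' \<Longrightarrow> (C', D') \<in> Q"
  obtains y where "tree_equiv y x" "edge_seps y \<subseteq> Q"
proof -
  define E where "E = edge_seps x \<union> prod.swap ` edge_seps x"
  have "\<exists>y. tree_equiv y (foldl Attach x []) \<and> edge_seps y \<subseteq> Q"
  proof (rule exists_sink_foldl)
    show "edge_seps (foldl Attach x []) \<subseteq> E" by (simp add: E_def)
    show "prod.swap ` E \<subseteq> E" by (simp add: E_def image_Un image_image)
    show "\<forall>C D. (C, D) \<in> E \<longrightarrow> (C, D) \<in> Q \<or> (D, C) \<in> Q"
      using assms(1) by (auto simp: E_def)
    show "\<forall>C D C' D'. (C, D) \<in> Q \<longrightarrow> (C', D') \<in> E \<longrightarrow> C' \<subseteq> C \<longrightarrow> D \<subseteq> D' \<longrightarrow> (C', D') \<in> Q"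
      using assms(2) unfolding E_def by blast
    show "edge_seps (foldl Attach x []) - (\<lambda>(C, D). (C, D \<union> \<Union>(verts_of ` set []))) ` edge_seps x \<subseteq> Q"
      by simp
  qed
  then show thesis using that by auto
qed

subsection \<open>Restricting a tree to one side of a separation\<close>

text \<open>
  \<open>Z\<close> collects the vertices of the subtrees that hang at the root of \<open>x\<close> in the surrounding tree: those
  lying in \<open>A \<inter> B\<close> are added to the root part.
\<close>

primrec restrict_tree :: "'a set \<Rightarrow> 'a set \<Rightarrow> 'a set \<Rightarrow> 'a part_tree \<Rightarrow> 'a part_tree" where
  "restrict_tree A B Z (Single X) = Single (A \<inter> X \<union> A \<inter> B \<inter> Z)"
| "restrict_tree A B Z (Attach a b) =
     Attach (restrict_tree A B (Z \<union> verts_of b) a) (restrict_tree A B {} b)"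

lemma verts_of_restrict_tree: "verts_of (restrict_tree A B Z x) = A \<inter> verts_of x \<union> A \<inter> B \<inter> Z"
  by (induction x arbitrary: Z) auto

lemma root_part_restrict_tree:
  "root_part (restrict_tree A B Z x) = A \<inter> root_part x \<union> A \<inter> B \<inter> (verts_of x \<union> Z)"
  by (induction x arbitrary: Z) auto

lemma coherent_restrict_tree: "coherent x \<Longrightarrow> coherent (restrict_tree A B Z x)"
  by (induction x arbitrary: Z) (auto simp: verts_of_restrict_tree root_part_restrict_tree)

text \<open>Every vertex of \<open>A \<inter> B\<close> has been pulled up to the root, so it
  appears on the root side of every edge.\<close>

lemma edge_seps_restrict_tree:
  "edge_seps (restrict_tree A B Z x) =
     (\<lambda>(C, D). (A \<inter> C, A \<inter> D \<union> A \<inter> B \<inter> (verts_of x \<union> Z))) ` edge_seps x"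
proof (induction x arbitrary: Z)
  case (Attach a b)
  have 1: "A \<inter> D \<union> A \<inter> B \<inter> (verts_of a \<union> (Z \<union> verts_of b)) \<union> A \<inter> verts_of b =
      A \<inter> (D \<union> verts_of b) \<union> A \<inter> B \<inter> (verts_of a \<union> verts_of b \<union> Z)" for D
    by blast
  have 2: "A \<inter> D \<union> A \<inter> B \<inter> (verts_of b \<union> {}) \<union>
        (A \<inter> verts_of a \<union> A \<inter> B \<inter> (verts_of a \<union> verts_of b \<union> Z)) =
      A \<inter> (D \<union> verts_of a) \<union> A \<inter> B \<inter> (verts_of a \<union> verts_of b \<union> Z)" for D
    by blast
  have 3: "A \<inter> verts_of b \<union> A \<inter> B \<inter> {} = A \<inter> verts_of b"
    "A \<inter> verts_of a \<union> A \<inter> B \<inter> (Z \<union> verts_of b) = A \<inter> verts_of a \<union> A \<inter> B \<inter> (verts_of a \<union> verts_of b \<union> Z)"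
    by blast+
  show ?case
    unfolding restrict_tree.simps edge_seps.simps verts_of.simps Attach verts_of_restrict_tree image_Un
      image_image case_prod_unfold fst_conv snd_conv image_insert image_empty 3 1 2 ..
qed simp

lemma parts_restrict_tree: "X \<in> parts x \<Longrightarrow> \<exists>Y\<in>parts (restrict_tree A B Z x). A \<inter> X \<subseteq> Y"
proof (induction x arbitrary: Z)
  case (Attach a b)
  then show ?case by (metis Un_iff parts.simps(2) restrict_tree.simps(2))
qed simp

definition split_tree :: "'a set \<Rightarrow> 'a set \<Rightarrow> 'a part_tree \<Rightarrow> 'a part_tree" where
  "split_tree A B x = Attach (restrict_tree A B {} x) (restrict_tree B A {} x)"

lemma verts_of_split_tree: "A \<union> B = verts_of x \<Longrightarrow> verts_of (split_tree A B x) = verts_of x"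
  by (auto simp: split_tree_def verts_of_restrict_tree)

text \<open>The two copies meet only in \<open>A \<inter> B\<close>, and all of its vertices in the
  tree have been added to both root parts.\<close>

lemma coherent_split_tree: "coherent x \<Longrightarrow> coherent (split_tree A B x)"
  by (auto simp: split_tree_def coherent_restrict_tree verts_of_restrict_tree root_part_restrict_tree)

text \<open>Seen from an edge in one copy, the whole other copy lies on the root side. Since
  \<open>C \<union> D = A \<union> B\<close>, the root side of an edge in the \<open>A\<close> copy
  simplifies to \<open>B \<union> D\<close>, and symmetrically in the \<open>B\<close> copy.\<close>

lemma edge_seps_split_tree:
  assumes "A \<union> B = verts_of x"
  shows "edge_seps (split_tree A B x) =
    (\<lambda>(C, D). (A \<inter> C, B \<union> D)) ` edge_seps x \<union> (\<lambda>(C, D). (B \<inter> C, A \<union> D)) ` edge_seps x \<union> {(B, A)}"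
proof -
  have 1: "A \<inter> snd p \<union> A \<inter> B \<inter> (verts_of x \<union> {}) \<union> (B \<inter> verts_of x \<union> B \<inter> A \<inter> {}) = B \<union> snd p"
    if "p \<in> edge_seps x" for p
  proof -
    have "fst p \<union> snd p = A \<union> B" using edge_seps_Un[of "fst p" "snd p"] that assms by simp
    then show ?thesis using assms by blast
  qed
  have 2: "B \<inter> snd p \<union> B \<inter> A \<inter> (verts_of x \<union> {}) \<union> (A \<inter> verts_of x \<union> A \<inter> B \<inter> {}) = A \<union> snd p"
    if "p \<in> edge_seps x" for p
  proof -
    have "fst p \<union> snd p = A \<union> B" using edge_seps_Un[of "fst p" "snd p"] that assms by simp
    then show ?thesis using assms by blast
  qed
  have 3: "B \<inter> verts_of x \<union> B \<inter> A \<inter> {} = B" "A \<inter> verts_of x \<union> A \<inter> B \<inter> {} = A"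
    using assms by blast+
  have 4: "(\<lambda>(C, D). (C, D \<union> (B \<inter> verts_of x \<union> B \<inter> A \<inter> {}))) `
      (\<lambda>(C, D). (A \<inter> C, A \<inter> D \<union> A \<inter> B \<inter> (verts_of x \<union> {}))) ` edge_seps x =
      (\<lambda>(C, D). (A \<inter> C, B \<union> D)) ` edge_seps x"
    unfolding image_image case_prod_unfold fst_conv snd_conv by (rule image_cong[OF refl]) (simp only: 1)
  have 5: "(\<lambda>(C, D). (C, D \<union> (A \<inter> verts_of x \<union> A \<inter> B \<inter> {}))) `
      (\<lambda>(C, D). (B \<inter> C, B \<inter> D \<union> B \<inter> A \<inter> (verts_of x \<union> {}))) ` edge_seps x =
      (\<lambda>(C, D). (B \<inter> C, A \<union> D)) ` edge_seps x"
    unfolding image_image case_prod_unfold fst_conv snd_conv by (rule image_cong[OF refl]) (simp only: 2)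
  show ?thesis
    unfolding split_tree_def edge_seps.simps edge_seps_restrict_tree verts_of_restrict_tree 4 5
    by (simp only: 3)
qed

lemma parts_split_tree:
  assumes "X \<in> parts x"
  shows "\<exists>Y\<in>parts (split_tree A B x). A \<inter> X \<subseteq> Y" "\<exists>Y\<in>parts (split_tree A B x). B \<inter> X \<subseteq> Y"
  unfolding split_tree_def parts.simps using parts_restrict_tree[OF assms] by (meson UnCI)+

subsection \<open>Uncrossing\<close>

definition sep_nested :: "'a set \<Rightarrow> 'a set \<Rightarrow> 'a set \<Rightarrow> 'a set \<Rightarrow> bool" where
  "sep_nested A B C D \<longleftrightarrow>
     C \<subseteq> A \<and> B \<subseteq> D \<or> C \<subseteq> B \<and> A \<subseteq> D \<or> A \<subseteq> C \<and> D \<subseteq> B \<or> B \<subseteq> C \<and> D \<subseteq> A"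

text \<open>Crossing an edge is tolerated if both halves have smaller order than the edge. The
  nestings with \<open>(A, B)\<close> or \<open>(B, A)\<close> below the edge are left out: the
  separation has to live at the root.\<close>

definition uncrossed :: "'a set \<Rightarrow> 'a set \<Rightarrow> 'a set \<Rightarrow> 'a set \<Rightarrow> bool" where
  "uncrossed A B C D \<longleftrightarrow>
     C \<subseteq> A \<and> B \<subseteq> D \<or> C \<subseteq> B \<and> A \<subseteq> D \<or>
     card (A \<inter> C \<inter> (B \<union> D)) < card (C \<inter> D) \<and> card (B \<inter> C \<inter> (A \<union> D)) < card (C \<inter> D)"

lemma sep_nested_swap: "sep_nested A B C D = sep_nested B A C D"
  by (auto simp: sep_nested_def)

lemma uncrossed_swap: "uncrossed A B C D = uncrossed B A C D"
  by (auto simp: uncrossed_def)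

text \<open>A form of the fish lemma: a separation nested with two crossing ones is nested with
  their corner. The combinations of nestings that do not give this would, by transitivity, make
  \<open>(A, B)\<close> and \<open>(C, D)\<close> nested.\<close>

lemma sep_nested_corner:
  assumes "\<not> sep_nested A B C D" "sep_nested A B C' D'"
    and "C \<subseteq> C' \<and> D' \<subseteq> D \<or> C' \<subseteq> C \<and> D \<subseteq> D' \<or> C \<subseteq> D' \<and> C' \<subseteq> D"
  shows "sep_nested (A \<union> C) (B \<inter> D) C' D'"
proof -
  have n: "\<not> (C \<subseteq> A \<and> B \<subseteq> D)" "\<not> (C \<subseteq> B \<and> A \<subseteq> D)" "\<not> (A \<subseteq> C \<and> D \<subseteq> B)" "\<not> (B \<subseteq> C \<and> D \<subseteq> A)"
    using assms(1) unfolding sep_nested_def by blast+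
  consider "C \<subseteq> C'" "D' \<subseteq> D" | "C' \<subseteq> C" "D \<subseteq> D'" | "C \<subseteq> D'" "C' \<subseteq> D"
    using assms(3) by blast
  note cases3 = this
  from assms(2) consider "C' \<subseteq> A" "B \<subseteq> D'" | "C' \<subseteq> B" "A \<subseteq> D'" | "A \<subseteq> C'" "D' \<subseteq> B" | "B \<subseteq> C'" "D' \<subseteq> A"
    unfolding sep_nested_def by blast
  then show ?thesis
  proof cases
    case 1
    then show ?thesis unfolding sep_nested_def by auto
  next
    case 2
    from cases3 show ?thesis
    proof cases
      case 1
      with 2 n(2) show ?thesis by (metis order_trans)
    qed (use 2 in \<open>auto simp: sep_nested_def\<close>)
  next
    case 3
    from cases3 show ?thesis
    proof cases
      case 1
      with 3 show ?thesis by (auto simp: sep_nested_def)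
    next
      case 2
      with 3 n(3) show ?thesis by (metis order_trans)
    next
      case c: 3
      with 3 n(2) show ?thesis by (metis order_trans)
    qed
  next
    case 4
    from cases3 show ?thesis
    proof cases
      case 1
      with 4 show ?thesis by (auto simp: sep_nested_def)
    next
      case 2
      with 4 n(4) show ?thesis by (metis order_trans)
    next
      case 3
      with 4 n(1) show ?thesis by (metis order_trans)
    qed
  qed
qed

text \<open>The separators of opposite corners lie in the union of the two given separators, and
  their intersection lies in both of these.\<close>

lemma sep_submodular:
  assumes "finite A" "finite B" "finite C" "finite D"
  shows "card ((A \<union> C) \<inter> (B \<inter> D)) + card (A \<inter> C \<inter> (B \<union> D)) \<le> card (A \<inter> B) + card (C \<inter> D)"
proof -
  let ?X = "(A \<union> C) \<inter> (B \<inter> D)" and ?Y = "A \<inter> C \<inter> (B \<union> D)"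
  have "card ?X + card ?Y = card (?X \<union> ?Y) + card (?X \<inter> ?Y)"
    using assms by (intro card_Un_Int) auto
  also have "\<dots> \<le> card (A \<inter> B \<union> C \<inter> D) + card (A \<inter> B \<inter> (C \<inter> D))"
    using assms by (intro add_mono card_mono) auto
  also have "\<dots> = card (A \<inter> B) + card (C \<inter> D)"
    using assms by (intro card_Un_Int[symmetric]) auto
  finally show ?thesis .
qed

lemma exists_uncrossed:
  assumes "F \<noteq> {}" "finite (verts_of x)"
    and swap: "\<And>A B. (A, B) \<in> F \<Longrightarrow> (B, A) \<in> F"
    and sub: "\<And>A B. (A, B) \<in> F \<Longrightarrow> A \<union> B \<subseteq> verts_of x \<and> card (A \<inter> B) \<le> l"
    and corner: "\<And>A B C D. (A, B) \<in> F \<Longrightarrow> (C, D) \<in> edge_seps x \<Longrightarrow>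
      card ((A \<union> C) \<inter> (B \<inter> D)) \<le> l \<Longrightarrow> (A \<union> C, B \<inter> D) \<in> F"
    and avoid: "\<And>A B C D. (A, B) \<in> F \<Longrightarrow> (C, D) \<in> edge_seps x \<Longrightarrow> \<not> (A \<subseteq> C \<and> D \<subseteq> B)"
  obtains A B where "(A, B) \<in> F" "\<And>C D. (C, D) \<in> edge_seps x \<Longrightarrow> uncrossed A B C D"
proof -
  define cr where "cr = (\<lambda>(A, B). {(C, D). (C, D) \<in> edge_seps x \<and> \<not> sep_nested A B C D})"
  have fin_cr: "finite (cr p)" for p
    by (rule finite_subset[OF _ finite_edge_seps[of x]]) (auto simp: cr_def)
  obtain A B where AB: "(A, B) \<in> F" and least: "\<And>p. p \<in> F \<Longrightarrow> card (cr (A, B)) \<le> card (cr p)"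
    using assms(1) ex_has_least_nat[of "\<lambda>p. p \<in> F" _ "\<lambda>p. card (cr p)"] by fastforce
  \<comment> \<open>The corner is nested with \<open>(C, D)\<close> and keeps all nestings of
    \<open>(P, R)\<close>, so it crosses fewer edges; minimality then forces its order above
    \<open>l\<close>. The general \<open>(P, R)\<close> covers both \<open>(A, B)\<close> and
    \<open>(B, A)\<close>.\<close>
  have big: "l < card ((P \<union> C) \<inter> (R \<inter> D))"
    if PR: "(P, R) \<in> F" "cr (P, R) = cr (A, B)" and CD: "(C, D) \<in> edge_seps x" "\<not> sep_nested P R C D"
    for P R C D
  proof (rule ccontr)
    assume "\<not> l < card ((P \<union> C) \<inter> (R \<inter> D))"
    then have mem: "(P \<union> C, R \<inter> D) \<in> F" using corner[OF PR(1) CD(1)] by simp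
    have "cr (P \<union> C, R \<inter> D) \<subseteq> cr (P, R)"
    proof -
      have "sep_nested (P \<union> C) (R \<inter> D) C' D'"
        if "(C', D') \<in> edge_seps x" "sep_nested P R C' D'" for C' D'
        using sep_nested_corner[OF CD(2) that(2) edge_seps_nested[OF CD(1) that(1)]] .
      then show ?thesis unfolding cr_def by auto
    qed
    moreover have "(C, D) \<in> cr (P, R)" using CD by (simp add: cr_def)
    moreover have "(C, D) \<notin> cr (P \<union> C, R \<inter> D)" by (auto simp: cr_def sep_nested_def)
    ultimately have "card (cr (P \<union> C, R \<inter> D)) < card (cr (P, R))"
      by (intro psubset_card_mono[OF fin_cr]) auto
    with least[OF mem] PR(2) show False by simp
  qed
  have "uncrossed A B C D" if CD: "(C, D) \<in> edge_seps x" for C D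
  proof (cases "sep_nested A B C D")
    case True
    then show ?thesis
      using avoid[OF AB CD] avoid[OF swap[OF AB] CD] unfolding sep_nested_def uncrossed_def by metis
  next
    case False
    have BA: "(B, A) \<in> F" "cr (B, A) = cr (A, B)" "\<not> sep_nested B A C D"
      using swap[OF AB] False by (auto simp: cr_def sep_nested_swap[of A B])
    have "A \<union> B \<subseteq> verts_of x" "C \<union> D \<subseteq> verts_of x" using sub[OF AB] edge_seps_Un[OF CD] by auto
    then have fin: "finite A" "finite B" "finite C" "finite D"
      using assms(2) by (meson finite_subset le_sup_iff)+
    \<comment> \<open>One corner has order above \<open>l\<close> and \<open>(A, B)\<close> has
      order at most \<open>l\<close>, so by submodularity the opposite corner has smaller order than
      the edge.\<close>
    have "card (A \<inter> C \<inter> (B \<union> D)) < card (C \<inter> D)"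
      using big[OF AB refl CD False] sep_submodular[OF fin(1,2,3,4)] sub[OF AB] by linarith
    moreover have "card (B \<inter> C \<inter> (A \<union> D)) < card (C \<inter> D)"
      using big[OF BA(1,2) CD BA(3)] sep_submodular[OF fin(2,1,3,4)] sub[OF BA(1)] by linarith
    ultimately show ?thesis by (simp add: uncrossed_def)
  qed
  with AB that show thesis by blast
qed

lemma uncrossed_card_le:
  assumes "finite (C \<inter> D)" "uncrossed A B C D" "A \<union> B = C \<union> D"
  shows "card (A \<inter> C \<inter> (B \<union> D)) \<le> card (C \<inter> D)" "card (B \<inter> C \<inter> (A \<union> D)) \<le> card (C \<inter> D)"
proof -
  have "card (A \<inter> C \<inter> (B \<union> D)) \<le> card (C \<inter> D)" if "uncrossed A B C D" "A \<union> B = C \<union> D" for A B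
  proof -
    from that(1) consider "C \<subseteq> A \<and> B \<subseteq> D" | "C \<subseteq> B \<and> A \<subseteq> D" | "card (A \<inter> C \<inter> (B \<union> D)) < card (C \<inter> D)"
      unfolding uncrossed_def by blast
    then show ?thesis
    proof cases
      case 3
      then show ?thesis by simp
    qed (rule card_mono[OF assms(1)], blast)+
  qed
  from this[OF assms(2,3)] this[of B A] assms(2,3)
  show "card (A \<inter> C \<inter> (B \<union> D)) \<le> card (C \<inter> D)" "card (B \<inter> C \<inter> (A \<union> D)) \<le> card (C \<inter> D)"
    by (auto simp: uncrossed_swap[of A B] Un_commute)
qed

subsection \<open>The weight of a tree\<close>

text \<open>Base 3 makes the weight drop when a part is replaced by two smaller ones, as
  \<open>2 * 3 ^ m < 3 ^ Suc m\<close>. Parts with fewer than \<open>k\<close> vertices are free,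
  since nested splits create additional ones.\<close>

definition part_weight :: "nat \<Rightarrow> 'a set \<Rightarrow> nat" where
  "part_weight k X = (if card X < k then 0 else 3 ^ card X)"

lemma part_weight_add_less:
  fixes X Y Z :: "'a set"
  assumes "card Y < card X" "card Z < card X"
  shows "part_weight k Y + part_weight k Z \<le> part_weight k X"
    and "k \<le> card X \<Longrightarrow> part_weight k Y + part_weight k Z < part_weight k X"
proof -
  obtain m where m: "card X = Suc m" using assms(1) by (cases "card X") auto
  have le: "part_weight k V \<le> 3 ^ m" if "card V < card X" for V :: "'a set"
    using that m by (simp add: part_weight_def power_increasing)
  have pos: "(0::nat) < 3 ^ m" by simp
  show less: "part_weight k Y + part_weight k Z < part_weight k X" if "k \<le> card X"
  proof -
    have "part_weight k X = 3 * 3 ^ m" using that m by (simp add: part_weight_def)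
    with le[OF assms(1)] le[OF assms(2)] pos show ?thesis by linarith
  qed
  show "part_weight k Y + part_weight k Z \<le> part_weight k X"
    using assms less by (cases "k \<le> card X") (auto simp: part_weight_def)
qed

text \<open>\<open>X\<close> is the part at the lower end of the edge \<open>(C, D)\<close>, hence
  contains \<open>C \<inter> D\<close>. In passing to the \<open>A\<close> copy these vertices are
  traded for the smaller separator of the half, and no other vertex is gained.\<close>

lemma card_restrict_part_less:
  assumes "finite C" "X \<subseteq> C" "C \<inter> D \<subseteq> X" "card (A \<inter> C \<inter> (B \<union> D)) < card (C \<inter> D)"
  shows "card (A \<inter> X \<union> A \<inter> B \<inter> C) < card X"
proof -
  have fX: "finite X" using assms(1,2) finite_subset by blast
  have "card (A \<inter> X \<union> A \<inter> B \<inter> C) \<le> card (A \<inter> C \<inter> (B \<union> D) \<union> (X - C \<inter> D))"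
    using assms(1,2) fX by (intro card_mono) auto
  also have "\<dots> \<le> card (A \<inter> C \<inter> (B \<union> D)) + card (X - C \<inter> D)" by (rule card_Un_le)
  also have "\<dots> < card (C \<inter> D) + card (X - C \<inter> D)" using assms(4) by simp
  also have "\<dots> = card X"
    using assms(1,3) fX by (metis Diff_disjoint Un_Diff_cancel card_Un_disjoint finite_Diff finite_Int sup.absorb2)
  finally show ?thesis .
qed

text \<open>If the edge is nested, one copy of the part is unchanged and the other lies in
  \<open>A \<inter> B\<close>, so it weighs nothing. If the edge is crossed, both copies are smaller
  than the part.\<close>

lemma part_weight_restrict:
  assumes "finite C" "X \<subseteq> C" "C \<inter> D \<subseteq> X" "finite A" "finite B" "card (A \<inter> B) < k" "uncrossed A B C D"
  shows "part_weight k (A \<inter> X \<union> A \<inter> B \<inter> C) + part_weight k (B \<inter> X \<union> B \<inter> A \<inter> C) \<le> part_weight k X"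
proof -
  have nested: "part_weight k (A \<inter> X \<union> A \<inter> B \<inter> C) + part_weight k (B \<inter> X \<union> B \<inter> A \<inter> C) \<le> part_weight k X"
    if "C \<subseteq> A" "B \<subseteq> D" "finite A" "card (A \<inter> B) < k" for A B
  proof -
    have "A \<inter> X \<union> A \<inter> B \<inter> C = X" using that assms(2,3) by blast
    moreover have "card (B \<inter> X \<union> B \<inter> A \<inter> C) \<le> card (A \<inter> B)"
      using that assms(2) by (intro card_mono) auto
    ultimately show ?thesis using that by (simp add: part_weight_def)
  qed
  from assms(7) consider "C \<subseteq> A" "B \<subseteq> D" | "C \<subseteq> B" "A \<subseteq> D"
    | "card (A \<inter> C \<inter> (B \<union> D)) < card (C \<inter> D)" "card (B \<inter> C \<inter> (A \<union> D)) < card (C \<inter> D)"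
    unfolding uncrossed_def by blast
  then show ?thesis
  proof cases
    case 1
    with nested assms show ?thesis by blast
  next
    case 2
    with nested[of B A] assms show ?thesis by (simp add: Int_commute add.commute)
  next
    case 3
    with assms card_restrict_part_less[of C X D] show ?thesis
      by (intro part_weight_add_less) auto
  qed
qed

text \<open>\<open>U\<close> collects the vertices of the surrounding tree outside the subtree, so
  that an edge \<open>(C, D)\<close> of \<open>x\<close> is \<open>(C, D \<union> U)\<close> in the
  whole tree. Each nonroot part is charged to the edge above it.\<close>

lemma nonroot_weight_restrict:
  assumes "coherent x" "finite (verts_of x)" "verts_of x \<inter> U \<subseteq> root_part x"
    and "finite A" "finite B" "card (A \<inter> B) < k"
    and "\<forall>C D. (C, D) \<in> edge_seps x \<longrightarrow> uncrossed A B C (D \<union> U)"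
  shows "nonroot_weight (part_weight k) (restrict_tree A B Z x) +
    nonroot_weight (part_weight k) (restrict_tree B A Z' x) \<le> nonroot_weight (part_weight k) x"
  using assms
proof (induction x arbitrary: U Z Z')
  case (Attach a b)
  have coh: "coherent a" "coherent b" "verts_of a \<inter> verts_of b \<subseteq> root_part a" "verts_of a \<inter> verts_of b \<subseteq> root_part b"
    using Attach.prems(1) by auto
  have U: "(verts_of a \<union> verts_of b) \<inter> U \<subseteq> root_part a" using Attach.prems(3) by simp
  have fin: "finite (verts_of a)" "finite (verts_of b)" using Attach.prems(2) by auto
  have ra: "root_part a \<subseteq> verts_of a" by (rule root_part_subset)
  have unc: "uncrossed A B C (D \<union> U)" if "(C, D) \<in> edge_seps (Attach a b)" for C D
    using that Attach.prems(7) by blast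
  have "\<forall>C D. (C, D) \<in> edge_seps a \<longrightarrow> uncrossed A B C (D \<union> (U \<union> verts_of b))"
  proof (intro allI impI)
    fix C D assume that: "(C, D) \<in> edge_seps a"
    have "(C, D \<union> verts_of b) \<in> edge_seps (Attach a b)" using that by (simp add: rev_image_eqI[OF that])
    from unc[OF this] show "uncrossed A B C (D \<union> (U \<union> verts_of b))" by (simp add: Un_ac)
  qed
  note edges_a = this
  have aU: "verts_of a \<inter> (U \<union> verts_of b) \<subseteq> root_part a" using U coh by blast
  have 1: "nonroot_weight (part_weight k) (restrict_tree A B (Z \<union> verts_of b) a) +
    nonroot_weight (part_weight k) (restrict_tree B A (Z' \<union> verts_of b) a) \<le> nonroot_weight (part_weight k) a"
    by (rule Attach.IH(1)[OF coh(1) fin(1) aU Attach.prems(4-6) edges_a])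
  have "\<forall>C D. (C, D) \<in> edge_seps b \<longrightarrow> uncrossed A B C (D \<union> (U \<union> verts_of a))"
  proof (intro allI impI)
    fix C D assume that: "(C, D) \<in> edge_seps b"
    have "(C, D \<union> verts_of a) \<in> edge_seps (Attach a b)" using that by (simp add: rev_image_eqI[OF that])
    from unc[OF this] show "uncrossed A B C (D \<union> (U \<union> verts_of a))" by (simp add: Un_ac)
  qed
  note edges_b = this
  have bU: "verts_of b \<inter> (U \<union> verts_of a) \<subseteq> root_part b" using U coh ra by blast
  have 2: "nonroot_weight (part_weight k) (restrict_tree A B {} b) +
    nonroot_weight (part_weight k) (restrict_tree B A {} b) \<le> nonroot_weight (part_weight k) b"
    by (rule Attach.IH(2)[OF coh(2) fin(2) bU Attach.prems(4-6) edges_b])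
  have "uncrossed A B (verts_of b) (verts_of a \<union> U)" using unc[of "verts_of b" "verts_of a"] by simp
  then have "part_weight k (A \<inter> root_part b \<union> A \<inter> B \<inter> verts_of b) +
    part_weight k (B \<inter> root_part b \<union> B \<inter> A \<inter> verts_of b) \<le> part_weight k (root_part b)"
    using bU fin Attach.prems(4-6) root_part_subset[of b]
    by (intro part_weight_restrict) (simp_all add: Un_commute)
  then show ?case using 1 2 by (simp add: root_part_restrict_tree)
qed simp

lemma weight_split_tree_less:
  assumes "coherent x" "finite (verts_of x)" "A \<union> B = verts_of x" "card (A \<inter> B) < k"
    and "k \<le> card (root_part x)"
    and "card (A \<inter> B) < card (A \<inter> root_part x)" "card (A \<inter> B) < card (B \<inter> root_part x)"
    and "\<And>C D. (C, D) \<in> edge_seps x \<Longrightarrow> uncrossed A B C D"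
  shows "weight (part_weight k) (split_tree A B x) < weight (part_weight k) x"
proof -
  let ?R = "root_part x"
  have fin: "finite A" "finite B" using assms(2,3) by (metis finite_Un)+
  have R: "?R \<subseteq> A \<union> B" using root_part_subset[of x] assms(3) by blast
  \<comment> \<open>More than \<open>card (A \<inter> B)\<close> vertices of the root part lie in
    \<open>B\<close>; in the \<open>A\<close> copy they are replaced by
    \<open>A \<inter> B\<close>.\<close>
  have less: "card (A \<inter> ?R \<union> A \<inter> B) < card ?R"
    if "finite A" "finite B" "?R \<subseteq> A \<union> B" "card (A \<inter> B) < card (B \<inter> ?R)" for A B
  proof -
    have "card (A \<inter> ?R \<union> A \<inter> B) \<le> card ((?R - B) \<union> A \<inter> B)"
      using that by (intro card_mono) (auto intro: finite_subset)
    also have "\<dots> \<le> card (?R - B) + card (A \<inter> B)" by (rule card_Un_le)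
    also have "\<dots> < card (?R - B) + card (B \<inter> ?R)" using that by simp
    also have "\<dots> = card ?R"
      using that finite_subset[of ?R "A \<union> B"] card_Int_Diff[of ?R B] by (simp add: Int_commute)
    finally show ?thesis .
  qed
  have "part_weight k (A \<inter> ?R \<union> A \<inter> B) + part_weight k (B \<inter> ?R \<union> B \<inter> A) < part_weight k ?R"
    using less[OF fin R assms(7)] less[of B A] fin R assms(5,6)
    by (intro part_weight_add_less) (simp_all add: Un_commute Int_commute)
  moreover have "nonroot_weight (part_weight k) (restrict_tree A B {} x) +
    nonroot_weight (part_weight k) (restrict_tree B A {} x) \<le> nonroot_weight (part_weight k) x"
    by (rule nonroot_weight_restrict[where U = "{}"]) (use assms fin in simp_all)
  moreover have "A \<inter> B \<inter> verts_of x = A \<inter> B" "B \<inter> A \<inter> verts_of x = B \<inter> A" using assms(3) by auto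
  ultimately show ?thesis
    by (simp add: split_tree_def weight_root root_part_restrict_tree)
qed

section \<open>Separations and profiles\<close>

lemma separations_swap: "(A, B) \<in> separations G \<Longrightarrow> (B, A) \<in> separations G"
  by (auto simp: separations_def)

lemma separations_corner:
  "(A, B) \<in> separations G \<Longrightarrow> (C, D) \<in> separations G \<Longrightarrow> (A \<union> C, B \<inter> D) \<in> separations G"
  unfolding separations_def by (auto simp: subset_iff)

lemma separations_Un: "(A, B) \<in> separations G \<Longrightarrow> A \<union> B = verts G"
  by (simp add: separations_def)

lemma finite_separations: "finite (verts G) \<Longrightarrow> finite (separations G)"
  by (rule finite_subset[of _ "Pow (verts G) \<times> Pow (verts G)"]) (auto simp: separations_def)

lemma separations_below_iff:
  "(A, B) \<in> separations_below G k \<longleftrightarrow> (A, B) \<in> separations G \<and> card (A \<inter> B) < k"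
  by (simp add: separations_below_def sep_order_def)

lemma regular_not_degenerate: "regular P \<Longrightarrow> s \<in> P \<Longrightarrow> \<not> degenerate s"
  by (cases s) (auto simp: regular_def co_small_def small_def sep_le_def degenerate_def)

section \<open>Regular profiles as sets closed downwards and under joins of small order\<close>

definition regular_profile :: "('a, 'b) pre_digraph \<Rightarrow> nat \<Rightarrow> 'a separation set \<Rightarrow> bool" where
  "regular_profile G k P \<longleftrightarrow> profile G k P \<and> regular P"

lemma regular_profile_subset: "regular_profile G k P \<Longrightarrow> P \<subseteq> separations_below G k"
  by (simp add: regular_profile_def profile_def orientation_def)

lemma finite_regular_profiles: "finite (verts G) \<Longrightarrow> finite {P. regular_profile G k P}"
  by (rule finite_subset[of _ "Pow (separations G)"])
    (auto simp: finite_separations separations_below_def dest!: regular_profile_subset)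

lemma regular_profile_total:
  "regular_profile G k P \<Longrightarrow> (A, B) \<in> separations_below G k \<Longrightarrow> (A, B) \<in> P \<or> (B, A) \<in> P"
  unfolding regular_profile_def profile_def orientation_def by (metis swap_simp)

lemma regular_profile_antisym:
  assumes "regular_profile G k P" "(A, B) \<in> P" shows "(B, A) \<notin> P"
proof -
  have "\<not> degenerate (A, B)" "(A, B) \<in> separations_below G k"
    using assms regular_not_degenerate regular_profile_subset unfolding regular_profile_def by blast+
  then show ?thesis
    using assms unfolding regular_profile_def profile_def orientation_def by (metis swap_simp)
qed

text \<open>Consistency does not compare the two orientations of one separation. In that remaining
  case \<open>(C, D)\<close> would be co-small, which regularity excludes.\<close>

lemma regular_profile_down:
  assumes P: "regular_profile G k P" and CD: "(C, D) \<in> P"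
    and AB: "(A, B) \<in> separations_below G k" "A \<subseteq> C" "D \<subseteq> B"
  shows "(A, B) \<in> P"
proof (rule ccontr)
  assume n: "(A, B) \<notin> P"
  then have BA: "(B, A) \<in> P" using regular_profile_total[OF P AB(1)] by blast
  have "(A, B) \<noteq> (D, C)"
  proof
    assume "(A, B) = (D, C)"
    then have "co_small (C, D)" using AB by (simp add: co_small_def small_def sep_le_def)
    with P CD show False by (auto simp: regular_profile_def regular_def)
  qed
  moreover have "(A, B) \<noteq> (C, D)" using n CD by blast
  moreover have "sep_less (A, B) (C, D)"
    using AB(2,3) \<open>(A, B) \<noteq> (C, D)\<close> by (simp add: sep_less_def sep_le_def)
  ultimately have "\<not> consistent P"
    unfolding consistent_def using BA CD by (metis swap_simp)
  with P show False by (simp add: regular_profile_def profile_def)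
qed

lemma regular_profile_join:
  assumes P: "regular_profile G k P" and "(A, B) \<in> P" "(C, D) \<in> P"
    and S: "(A \<union> C, B \<inter> D) \<in> separations_below G k"
  shows "(A \<union> C, B \<inter> D) \<in> P"
proof -
  have "prod.swap (sep_join (A, B) (C, D)) \<notin> P"
    using assms(1-3) unfolding regular_profile_def profile_def by blast
  then show ?thesis using regular_profile_total[OF P S] by (simp add: sep_join_def)
qed

lemma distinguishes_regular:
  assumes "regular_profile G k P" "regular_profile G k Q"
  shows "distinguishes (A, B) P Q \<longleftrightarrow> (A, B) \<in> P \<and> (B, A) \<in> Q \<or> (B, A) \<in> P \<and> (A, B) \<in> Q"
  using regular_not_degenerate[of P "(A, B)"] regular_not_degenerate[of Q "(A, B)"] assms
  unfolding distinguishes_def regular_profile_def by auto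

lemma efficiently_distinguishes_swap:
  "efficiently_distinguishes (B, A) P Q = efficiently_distinguishes (A, B) P Q"
  by (auto simp: efficiently_distinguishes_def distinguishes_def degenerate_def sep_order_def Int_commute)

lemma efficiently_distinguishes_commute:
  "efficiently_distinguishes s P Q = efficiently_distinguishes s Q P"
  unfolding efficiently_distinguishes_def distinguishes_def by metis

section \<open>Decomposition trees\<close>

definition decomposes :: "('a, 'b) pre_digraph \<Rightarrow> 'a part_tree \<Rightarrow> bool" where
  "decomposes G x \<longleftrightarrow> coherent x \<and> verts_of x = verts G \<and>
     (\<forall>e\<in>arcs G. \<exists>X\<in>parts x. e \<in> arcs (G \<restriction> X))"

definition adhesion_below :: "'a part_tree \<Rightarrow> nat \<Rightarrow> bool" where
  "adhesion_below x m \<longleftrightarrow> (\<forall>C D. (C, D) \<in> edge_seps x \<longrightarrow> card (C \<inter> D) < m)"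

definition tree_distinguishes ::
  "'a part_tree \<Rightarrow> 'a separation set \<Rightarrow> 'a separation set \<Rightarrow> bool" where
  "tree_distinguishes x P Q \<longleftrightarrow> (\<exists>s\<in>edge_seps x. efficiently_distinguishes s P Q)"

lemma tree_equiv_edge:
  assumes "tree_equiv y x" "(C, D) \<in> edge_seps y"
  shows "(C, D) \<in> edge_seps x \<or> (D, C) \<in> edge_seps x"
proof -
  have "(C, D) \<in> edge_seps x \<union> prod.swap ` edge_seps x"
    using assms unfolding tree_equiv_def by blast
  then show ?thesis by auto
qed

lemma tree_equiv_decomposes: "tree_equiv y x \<Longrightarrow> decomposes G y = decomposes G x"
  by (simp add: tree_equiv_def decomposes_def)

lemma tree_equiv_adhesion_below: "tree_equiv y x \<Longrightarrow> adhesion_below x m \<Longrightarrow> adhesion_below y m"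
  unfolding adhesion_below_def using tree_equiv_edge by (metis Int_commute)

lemma tree_equiv_distinguishes:
  assumes "tree_equiv y x" "tree_distinguishes y P Q" shows "tree_distinguishes x P Q"
proof -
  obtain C D where "(C, D) \<in> edge_seps y" "efficiently_distinguishes (C, D) P Q"
    using assms(2) unfolding tree_distinguishes_def by auto
  then show ?thesis
    using tree_equiv_edge[OF assms(1)] efficiently_distinguishes_swap unfolding tree_distinguishes_def
    by metis
qed

lemma decomposes_arc:
  assumes "decomposes G x" "e \<in> arcs G"
  obtains X where "X \<in> parts x" "e \<in> arcs (G \<restriction> X)"
  using assms by (auto simp: decomposes_def simp del: induce_subgraph_arcs)

lemma decomposes_edge_seps:
  assumes "decomposes G x" "(C, D) \<in> edge_seps x"
  shows "(C, D) \<in> separations G"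
proof -
  have "e \<in> arcs (G \<restriction> C) \<union> arcs (G \<restriction> D)" if e: "e \<in> arcs G" for e
  proof -
    obtain X where X: "X \<in> parts x" "e \<in> arcs (G \<restriction> X)"
      using assms(1) e by (rule decomposes_arc)
    from part_edge_sep[OF X(1) assms(2)] show ?thesis
      using X(2) by (elim disjE) (simp_all add: subset_iff)
  qed
  moreover have "C \<union> D = verts G"
    using assms edge_seps_Un[OF assms(2)] by (simp add: decomposes_def)
  ultimately show ?thesis by (auto simp: separations_def)
qed

lemma decomposes_split_tree:
  assumes "decomposes G x" "(A, B) \<in> separations G"
  shows "decomposes G (split_tree A B x)"
proof -
  have "\<exists>Y\<in>parts (split_tree A B x). e \<in> arcs (G \<restriction> Y)" if e: "e \<in> arcs G" for e
  proof -
    obtain X where X: "X \<in> parts x" "e \<in> arcs (G \<restriction> X)"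
      using assms(1) e by (rule decomposes_arc)
    have "e \<in> arcs (G \<restriction> A) \<union> arcs (G \<restriction> B)" using assms(2) e by (auto simp: separations_def)
    then consider "e \<in> arcs (G \<restriction> (A \<inter> X))" | "e \<in> arcs (G \<restriction> (B \<inter> X))" using X(2) by auto
    then show ?thesis
    proof cases
      case 1
      obtain Y where "Y \<in> parts (split_tree A B x)" "A \<inter> X \<subseteq> Y"
        using parts_split_tree(1)[OF X(1)] by blast
      with 1 show ?thesis by (intro bexI[of _ Y]) auto
    next
      case 2
      obtain Y where "Y \<in> parts (split_tree A B x)" "B \<inter> X \<subseteq> Y"
        using parts_split_tree(2)[OF X(1)] by blast
      with 2 show ?thesis by (intro bexI[of _ Y]) auto
    qed
  qed
  then show ?thesis
    using assms separations_Un[OF assms(2)]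
    by (simp add: decomposes_def coherent_split_tree verts_of_split_tree)
qed

lemma edge_seps_split_tree_cases:
  assumes "decomposes G x" "(A, B) \<in> separations G" "s \<in> edge_seps (split_tree A B x)"
  obtains C D where "(C, D) \<in> edge_seps x" "s = (A \<inter> C, B \<union> D)"
  | C D where "(C, D) \<in> edge_seps x" "s = (B \<inter> C, A \<union> D)"
  | "s = (B, A)"
proof -
  have "A \<union> B = verts_of x" using assms by (simp add: decomposes_def separations_Un)
  from assms(3)[unfolded edge_seps_split_tree[OF this]] that show thesis by auto
qed

lemma edge_seps_split_treeI:
  assumes "decomposes G x" "(A, B) \<in> separations G"
  shows "(C, D) \<in> edge_seps x \<Longrightarrow> (A \<inter> C, B \<union> D) \<in> edge_seps (split_tree A B x)"
    and "(C, D) \<in> edge_seps x \<Longrightarrow> (B \<inter> C, A \<union> D) \<in> edge_seps (split_tree A B x)"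
    and "(B, A) \<in> edge_seps (split_tree A B x)"
proof -
  have "A \<union> B = verts_of x" using assms by (simp add: decomposes_def separations_Un)
  from edge_seps_split_tree[OF this]
  show "(C, D) \<in> edge_seps x \<Longrightarrow> (A \<inter> C, B \<union> D) \<in> edge_seps (split_tree A B x)"
    and "(C, D) \<in> edge_seps x \<Longrightarrow> (B \<inter> C, A \<union> D) \<in> edge_seps (split_tree A B x)"
    and "(B, A) \<in> edge_seps (split_tree A B x)"
    by (auto intro: rev_image_eqI)
qed

lemma uncrossed_edge_card_le:
  assumes "finite (verts G)" "decomposes G x" "(A, B) \<in> separations G"
    and "(C, D) \<in> edge_seps x" "uncrossed A B C D"
  shows "card (A \<inter> C \<inter> (B \<union> D)) \<le> card (C \<inter> D)" "card (B \<inter> C \<inter> (A \<union> D)) \<le> card (C \<inter> D)"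
proof -
  have "C \<union> D = verts G" "A \<union> B = verts G"
    using decomposes_edge_seps[OF assms(2,4)] assms(3) separations_Un by blast+
  then have "finite (C \<inter> D)" "A \<union> B = C \<union> D" using assms(1) by (auto intro: finite_subset)
  then show "card (A \<inter> C \<inter> (B \<union> D)) \<le> card (C \<inter> D)" "card (B \<inter> C \<inter> (A \<union> D)) \<le> card (C \<inter> D)"
    using uncrossed_card_le assms(5) by blast+
qed

lemma adhesion_below_split_tree:
  assumes "finite (verts G)" "decomposes G x" "(A, B) \<in> separations G" "card (A \<inter> B) < m"
    and "adhesion_below x m" "\<And>C D. (C, D) \<in> edge_seps x \<Longrightarrow> uncrossed A B C D"
  shows "adhesion_below (split_tree A B x) m"
  unfolding adhesion_below_def
proof (intro allI impI)
  fix C' D' assume "(C', D') \<in> edge_seps (split_tree A B x)"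
  from edge_seps_split_tree_cases[OF assms(2,3) this] show "card (C' \<inter> D') < m"
  proof cases
    case (1 C D)
    then show ?thesis
      using uncrossed_edge_card_le(1)[OF assms(1-3) 1(1) assms(6)[OF 1(1)]] assms(5)
      unfolding adhesion_below_def by fastforce
  next
    case (2 C D)
    then show ?thesis
      using uncrossed_edge_card_le(2)[OF assms(1-3) 2(1) assms(6)[OF 2(1)]] assms(5)
      unfolding adhesion_below_def by fastforce
  next
    case 3
    then show ?thesis using assms(4) by (simp add: Int_commute)
  qed
qed

text \<open>
  If \<open>(C, D) \<in> P\<close>, \<open>(D, C) \<in> Q\<close> and, say, \<open>(A, B) \<in> Q\<close>, then \<open>Q\<close> contains the join \<open>(A \<union> D, B \<inter> C)\<close>, and \<open>P\<close>
  contains its inverse, which lies below \<open>(C, D)\<close>: one half of the edge still distinguishes.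
\<close>

lemma tree_distinguishes_split_tree:
  assumes fin: "finite (verts G)" and x: "decomposes G x" "adhesion_below x k"
    and AB: "(A, B) \<in> separations_below G k"
    and unc: "\<And>C D. (C, D) \<in> edge_seps x \<Longrightarrow> uncrossed A B C D"
    and P: "regular_profile G k P" and Q: "regular_profile G k Q"
    and dist: "tree_distinguishes x P Q"
  shows "tree_distinguishes (split_tree A B x) P Q"
proof -
  have AB': "(A, B) \<in> separations G" using AB by (simp add: separations_below_iff)
  have main: "tree_distinguishes (split_tree A B x) P Q"
    if P: "regular_profile G k P" and Q: "regular_profile G k Q"
      and CD: "(C, D) \<in> edge_seps x" "(C, D) \<in> P" "(D, C) \<in> Q"
      and eff: "efficiently_distinguishes (C, D) P Q" for P Q C D
  proof -
    \<comment> \<open>\<open>(S, R)\<close> is whichever orientation of the splitting separation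
      belongs to \<open>Q\<close>. The half on the other side distinguishes with no larger order, so
      efficiency is inherited from \<open>(C, D)\<close>.\<close>
    have half: "\<exists>s\<in>edge_seps (split_tree A B x). efficiently_distinguishes s P Q"
      if "(S, R) \<in> Q" "(S, R) \<in> separations G" "card (R \<inter> C \<inter> (S \<union> D)) \<le> card (C \<inter> D)"
        "(R \<inter> C, S \<union> D) \<in> edge_seps (split_tree A B x)" for S R
    proof -
      have C: "(C, D) \<in> separations G" "(D, C) \<in> separations G" "card (C \<inter> D) < k"
        using decomposes_edge_seps[OF x(1) CD(1)] x(2) CD(1)
        by (auto simp: adhesion_below_def separations_swap)
      have b: "(S \<union> D, R \<inter> C) \<in> separations_below G k"
        using separations_corner[OF that(2) C(2)] that(3) C(3)
        by (simp add: separations_below_iff Int_commute)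
      then have b': "(R \<inter> C, S \<union> D) \<in> separations_below G k"
        by (auto simp: separations_below_iff Int_commute intro: separations_swap)
      have "(S \<union> D, R \<inter> C) \<in> Q" using regular_profile_join[OF Q that(1) CD(3) b] .
      moreover have "(R \<inter> C, S \<union> D) \<in> P" using regular_profile_down[OF P CD(2) b'] by blast
      ultimately have "distinguishes (R \<inter> C, S \<union> D) P Q"
        by (simp add: distinguishes_regular[OF P Q])
      moreover have "sep_order (R \<inter> C, S \<union> D) \<le> sep_order (C, D)"
        using that(3) by (simp add: sep_order_def)
      ultimately have "efficiently_distinguishes (R \<inter> C, S \<union> D) P Q"
        using eff unfolding efficiently_distinguishes_def by fastforce
      with that(4) show ?thesis by blast
    qed
    note card_le = uncrossed_edge_card_le[OF fin x(1) AB' CD(1) unc[OF CD(1)]]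
    note edges = edge_seps_split_treeI[OF x(1) AB']
    from regular_profile_total[OF Q AB] show ?thesis
    proof
      assume "(A, B) \<in> Q"
      from half[OF this AB' card_le(2) edges(2)[OF CD(1)]] show ?thesis
        by (simp add: tree_distinguishes_def)
    next
      assume "(B, A) \<in> Q"
      from half[OF this separations_swap[OF AB'] card_le(1) edges(1)[OF CD(1)]] show ?thesis
        by (simp add: tree_distinguishes_def)
    qed
  qed
  obtain C D where CD: "(C, D) \<in> edge_seps x" "efficiently_distinguishes (C, D) P Q"
    using dist unfolding tree_distinguishes_def by auto
  then consider "(C, D) \<in> P" "(D, C) \<in> Q" | "(C, D) \<in> Q" "(D, C) \<in> P"
    using distinguishes_regular[OF P Q] unfolding efficiently_distinguishes_def by blast
  then show ?thesis
  proof cases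
    case 1
    from main[OF P Q CD(1) 1 CD(2)] show ?thesis .
  next
    case 2
    have "efficiently_distinguishes (C, D) Q P" using CD(2) efficiently_distinguishes_commute by blast
    from main[OF Q P CD(1) 2 this] show ?thesis
      unfolding tree_distinguishes_def using efficiently_distinguishes_commute by blast
  qed
qed

section \<open>Distinguishing all regular profiles\<close>

definition distinguishable_below ::
  "nat \<Rightarrow> 'a separation set \<Rightarrow> 'a separation set \<Rightarrow> bool" where
  "distinguishable_below m P Q \<longleftrightarrow> (\<exists>r. distinguishes r P Q \<and> sep_order r < m)"

text \<open>The tree is rooted at a sink of \<open>P\<close>. An edge oriented differently by
  \<open>Q\<close> would have order at most \<open>m\<close> and so distinguish efficiently; hence
  \<open>Q\<close> also directs all edges to this root, and the distinguishers of order at most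
  \<open>m\<close> meet the requirements for uncrossing.\<close>

lemma exists_uncrossed_distinguisher:
  assumes fin: "finite (verts G)" and x: "decomposes G x" "adhesion_below x (Suc m)" and "m < k"
    and P: "regular_profile G k P" and Q: "regular_profile G k Q"
    and dist: "distinguishable_below (Suc m) P Q" "\<not> distinguishable_below m P Q"
    and n: "\<not> tree_distinguishes x P Q"
  obtains y A B where "tree_equiv y x" "(A, B) \<in> separations G" "card (A \<inter> B) \<le> m"
    "distinguishes (A, B) P Q" "\<And>C D. (C, D) \<in> edge_seps y \<Longrightarrow> uncrossed A B C D"
proof -
  have below: "(C, D) \<in> separations_below G k \<and> (D, C) \<in> separations_below G k"
    if "(C, D) \<in> edge_seps x" for C D
    using decomposes_edge_seps[OF x(1) that] x(2) that \<open>m < k\<close>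
    by (auto simp: separations_below_iff adhesion_below_def Int_commute separations_swap)
       (meson less_le_trans Suc_leI)+
  obtain y where y: "tree_equiv y x" "edge_seps y \<subseteq> P"
  proof (rule exists_sink[of x P])
    show "(C, D) \<in> P \<or> (D, C) \<in> P" if "(C, D) \<in> edge_seps x" for C D
      using regular_profile_total[OF P] below[OF that] by blast
    show "(C', D') \<in> P" if "(C, D) \<in> P" "(C', D') \<in> edge_seps x \<union> prod.swap ` edge_seps x"
      "C' \<subseteq> C" "D \<subseteq> D'" for C D C' D'
      by (rule regular_profile_down[OF P that(1)]) (use that below in auto)
  qed (use that in blast)
  have y_dec: "decomposes G y" using y(1) x(1) tree_equiv_decomposes by blast
  have y_adh: "adhesion_below y (Suc m)" using y(1) x(2) tree_equiv_adhesion_below by blast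
  have yP: "(C, D) \<in> P" if "(C, D) \<in> edge_seps y" for C D using y(2) that by blast
  have yS: "(C, D) \<in> separations G" if "(C, D) \<in> edge_seps y" for C D
    using decomposes_edge_seps[OF y_dec that] .
  have yQ: "(C, D) \<in> Q" if CD: "(C, D) \<in> edge_seps y" for C D
  proof (rule ccontr)
    assume "(C, D) \<notin> Q"
    moreover have "(C, D) \<in> separations_below G k" using yP[OF CD] regular_profile_subset[OF P] by blast
    ultimately have "(D, C) \<in> Q" using regular_profile_total[OF Q] by blast
    then have "distinguishes (C, D) P Q" using yP[OF CD] by (simp add: distinguishes_regular[OF P Q])
    moreover have "sep_order (C, D) \<le> m"
      using y_adh CD unfolding adhesion_below_def sep_order_def by fastforce
    ultimately have "efficiently_distinguishes (C, D) P Q"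
      using dist(2) unfolding distinguishable_below_def efficiently_distinguishes_def by fastforce
    with CD have "tree_distinguishes y P Q" unfolding tree_distinguishes_def by blast
    with n tree_equiv_distinguishes[OF y(1)] show False by blast
  qed
  define F where "F = {(A, B). (A, B) \<in> separations G \<and> card (A \<inter> B) \<le> m \<and> distinguishes (A, B) P Q}"
  obtain A B where AB: "(A, B) \<in> F" "\<And>C D. (C, D) \<in> edge_seps y \<Longrightarrow> uncrossed A B C D"
  proof (rule exists_uncrossed[of F y m])
    obtain A B where r: "distinguishes (A, B) P Q" "sep_order (A, B) < Suc m"
      using dist(1) unfolding distinguishable_below_def by auto
    then have "(A, B) \<in> separations_below G k \<or> (B, A) \<in> separations_below G k"
      using regular_profile_subset[OF P] by (auto simp: distinguishes_def)
    then have "(A, B) \<in> separations G" using separations_swap by (auto simp: separations_below_iff)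
    with r have "(A, B) \<in> F" by (simp add: F_def sep_order_def)
    then show "F \<noteq> {}" by blast
    have yv: "verts_of y = verts G" using y_dec by (simp add: decomposes_def)
    show "finite (verts_of y)" using fin yv by simp
    show "(B, A) \<in> F" if "(A, B) \<in> F" for A B
      using that separations_swap[of A B G] by (auto simp: F_def distinguishes_regular[OF P Q] Int_commute)
    show "A \<union> B \<subseteq> verts_of y \<and> card (A \<inter> B) \<le> m" if "(A, B) \<in> F" for A B
      using that yv separations_Un[of A B G] by (simp add: F_def)
    \<comment> \<open>The edge belongs to both profiles. The one containing \<open>(A, B)\<close>
      contains the corner as a join, and the other contains its inverse, which lies below
      \<open>(B, A)\<close>.\<close>
    show "(A \<union> C, B \<inter> D) \<in> F"
      if F: "(A, B) \<in> F" and CD: "(C, D) \<in> edge_seps y" and le: "card ((A \<union> C) \<inter> (B \<inter> D)) \<le> m" for A B C D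
    proof -
      have S: "(A \<union> C, B \<inter> D) \<in> separations G"
        using separations_corner yS[OF CD] F by (auto simp: F_def)
      then have S': "(A \<union> C, B \<inter> D) \<in> separations_below G k" "(B \<inter> D, A \<union> C) \<in> separations_below G k"
        using le \<open>m < k\<close> separations_swap[OF S] by (auto simp: separations_below_iff Int_commute)
      have "(A \<union> C, B \<inter> D) \<in> P \<and> (B \<inter> D, A \<union> C) \<in> Q"
        if "(A, B) \<in> P" "(B, A) \<in> Q" "(C, D) \<in> P"
          and P: "regular_profile G k P" and Q: "regular_profile G k Q" for P Q
        using regular_profile_join[OF P that(1,3) S'(1)] regular_profile_down[OF Q that(2) S'(2)] by blast
      then have "distinguishes (A \<union> C, B \<inter> D) P Q"
        using F yP[OF CD] yQ[OF CD] P Q unfolding F_def distinguishes_regular[OF P Q] by blast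
      with S le show ?thesis by (simp add: F_def)
    qed
    \<comment> \<open>A separation below an edge belongs to both profiles together with that edge,
      so it cannot distinguish them.\<close>
    show "\<not> (A \<subseteq> C \<and> D \<subseteq> B)" if F: "(A, B) \<in> F" and CD: "(C, D) \<in> edge_seps y" for A B C D
    proof
      assume le: "A \<subseteq> C \<and> D \<subseteq> B"
      have "(A, B) \<in> separations_below G k" using F \<open>m < k\<close> by (simp add: F_def separations_below_iff)
      then have "(A, B) \<in> P" "(A, B) \<in> Q"
        using le regular_profile_down[OF P yP[OF CD]] regular_profile_down[OF Q yQ[OF CD]] by blast+
      then show False
        using F regular_profile_antisym P Q unfolding F_def distinguishes_regular[OF P Q] by blast
    qed
  qed (use that in blast)
  with y(1) that show thesis unfolding F_def by blast
qed

text \<open>Going from \<open>m\<close> to \<open>Suc m\<close>, the pairs still to be distinguished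
  need order exactly \<open>m\<close>, so any distinguisher of that order is efficient. A tree with
  the fewest undistinguished pairs has none, since a split handles one more pair and keeps the
  others.\<close>

lemma exists_distinguishing_tree:
  fixes G :: "('a, 'b) pre_digraph"
  assumes fin: "finite (verts G)" and wf: "wf_digraph G" and "m \<le> k"
  shows "\<exists>x. decomposes G x \<and> adhesion_below x m \<and>
    (\<forall>P Q. regular_profile G k P \<longrightarrow> regular_profile G k Q \<longrightarrow> distinguishable_below m P Q \<longrightarrow>
      tree_distinguishes x P Q)"
  using \<open>m \<le> k\<close>
proof (induction m)
  case 0
  have "decomposes G (Single (verts G))"
    using wf by (auto simp: decomposes_def wf_digraph_def)
  then show ?case
    by (intro exI[of _ "Single (verts G)"]) (simp add: adhesion_below_def distinguishable_below_def)
next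
  case (Suc m)
  define good where "good = (\<lambda>x. decomposes G x \<and> adhesion_below x (Suc m) \<and>
    (\<forall>P Q. regular_profile G k P \<longrightarrow> regular_profile G k Q \<longrightarrow> distinguishable_below m P Q \<longrightarrow>
      tree_distinguishes x P Q))"
  define bad where "bad = (\<lambda>x. {(P, Q). regular_profile G k P \<and> regular_profile G k Q \<and>
    distinguishable_below (Suc m) P Q \<and> \<not> tree_distinguishes x P Q})"
  have fin_bad: "finite (bad x)" for x
    by (rule finite_subset[of _ "{P. regular_profile G k P} \<times> {P. regular_profile G k P}"])
      (auto simp: bad_def finite_regular_profiles[OF fin])
  obtain x0 where "good x0"
    using Suc by (auto simp: good_def adhesion_below_def) (meson less_SucI)
  then obtain x where x: "good x" and least: "\<And>y. good y \<Longrightarrow> card (bad x) \<le> card (bad y)"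
    using ex_has_least_nat[of good x0 "\<lambda>x. card (bad x)"] by blast
  have "bad x = {}"
  proof (rule ccontr)
    assume "bad x \<noteq> {}"
    then obtain P Q where PQ: "regular_profile G k P" "regular_profile G k Q"
      "distinguishable_below (Suc m) P Q" "\<not> tree_distinguishes x P Q"
      by (auto simp: bad_def)
    have nd: "\<not> distinguishable_below m P Q" using PQ x by (auto simp: good_def)
    have xd: "decomposes G x" "adhesion_below x (Suc m)" using x by (auto simp: good_def)
    obtain y A B where y: "tree_equiv y x" and AB: "(A, B) \<in> separations G" "card (A \<inter> B) \<le> m"
      "distinguishes (A, B) P Q" and unc: "\<And>C D. (C, D) \<in> edge_seps y \<Longrightarrow> uncrossed A B C D"
      using exists_uncrossed_distinguisher[OF fin xd _ PQ(1,2,3) nd PQ(4)] Suc.prems by (metis Suc_le_lessD)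
    have yd: "decomposes G y" "adhesion_below y (Suc m)"
      using y xd tree_equiv_decomposes tree_equiv_adhesion_below by blast+
    let ?z = "split_tree A B y"
    have yk: "adhesion_below y k" using yd(2) Suc.prems unfolding adhesion_below_def by (meson less_le_trans)
    have ABk: "(A, B) \<in> separations_below G k" using AB Suc.prems by (simp add: separations_below_iff)
    have keep: "tree_distinguishes ?z P' Q'"
      if "regular_profile G k P'" "regular_profile G k Q'" "tree_distinguishes x P' Q'" for P' Q'
      using tree_distinguishes_split_tree[OF fin yd(1) yk ABk unc that(1,2)]
        tree_equiv_distinguishes[OF tree_equiv_sym[OF y] that(3)] by blast
    have "adhesion_below ?z (Suc m)"
      by (rule adhesion_below_split_tree[OF fin yd(1) AB(1) _ yd(2) unc]) (use AB in auto)
    then have "good ?z"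
      using x keep decomposes_split_tree[OF yd(1) AB(1)] by (auto simp: good_def)
    have "efficiently_distinguishes (A, B) P Q"
      using AB(2,3) nd unfolding efficiently_distinguishes_def distinguishable_below_def sep_order_def
      by fastforce
    then have "tree_distinguishes ?z P Q"
      unfolding tree_distinguishes_def using efficiently_distinguishes_swap edge_seps_split_treeI(3)[OF yd(1) AB(1)]
      by blast
    then have "(P, Q) \<in> bad x - bad ?z" using PQ by (simp add: bad_def)
    moreover have "bad ?z \<subseteq> bad x" using keep by (auto simp: bad_def)
    ultimately have "card (bad ?z) < card (bad x)"
      by (intro psubset_card_mono[OF fin_bad]) auto
    with least[OF \<open>good ?z\<close>] show False by simp
  qed
  then show ?case using x unfolding good_def bad_def by blast
qed

section \<open>Lean parts\<close>

text \<open>By Menger's theorem, for a part of the graph this means that any two subsets of the part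
  of equal size at most \<open>k\<close> are joined by that many disjoint paths.\<close>

definition lean_part :: "('a, 'b) pre_digraph \<Rightarrow> nat \<Rightarrow> 'a set \<Rightarrow> bool" where
  "lean_part G k X \<longleftrightarrow> (\<forall>A B. (A, B) \<in> separations_below G k \<longrightarrow>
     card (A \<inter> X) \<le> card (A \<inter> B) \<or> card (B \<inter> X) \<le> card (A \<inter> B))"

text \<open>The tree is rooted at a part containing \<open>X\<close>, found as the sink of the
  orientation towards \<open>X\<close>. This root part inherits the failure of leanness from
  \<open>X\<close>.\<close>

lemma exists_uncrossed_split:
  assumes fin: "finite (verts G)" and x: "decomposes G x"
    and X: "X \<in> parts x" "\<not> lean_part G k X"
  obtains y A B where "tree_equiv y x" "(A, B) \<in> separations_below G k" "X \<subseteq> root_part y"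
    "card (A \<inter> B) < card (A \<inter> root_part y)" "card (A \<inter> B) < card (B \<inter> root_part y)"
    "\<And>C D. (C, D) \<in> edge_seps y \<Longrightarrow> uncrossed A B C D"
proof -
  obtain A0 B0 where AB0: "(A0, B0) \<in> separations_below G k"
    "card (A0 \<inter> B0) < card (A0 \<inter> X)" "card (A0 \<inter> B0) < card (B0 \<inter> X)"
    using X(2) unfolding lean_part_def by (meson not_le)
  obtain y where y: "tree_equiv y x" "edge_seps y \<subseteq> {(C, D). X \<subseteq> D}"
  proof (rule exists_sink[of x "{(C, D). X \<subseteq> D}"])
    show "(C, D) \<in> {(C, D). X \<subseteq> D} \<or> (D, C) \<in> {(C, D). X \<subseteq> D}" if "(C, D) \<in> edge_seps x" for C D
      using part_edge_sep[OF X(1) that] by auto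
  qed (use that in blast)+
  have yd: "decomposes G y" using y(1) x tree_equiv_decomposes by blast
  then have yv: "verts_of y = verts G" "coherent y" by (auto simp: decomposes_def)
  let ?R = "root_part y"
  have fR: "finite ?R" using fin yv root_part_subset[of y] by (metis finite_subset)
  have XR: "X \<subseteq> ?R"
  proof
    fix v assume v: "v \<in> X"
    have "X \<subseteq> verts_of y" using X(1) y(1) Union_parts[of x] by (auto simp: tree_equiv_def)
    then show "v \<in> ?R" using v y(2) by (intro in_root_partI[OF yv(2)]) auto
  qed
  \<comment> \<open>The bound is fixed as the order of the initial separation instead of varying
    with the member of \<open>F\<close>, so \<open>F\<close> is closed under corners of order at
    most \<open>l\<close>: these keep the root vertices of both \<open>A\<close> and
    \<open>B\<close>.\<close>
  define l where "l = card (A0 \<inter> B0)"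
  define F where "F = {(A, B). (A, B) \<in> separations G \<and> card (A \<inter> B) \<le> l \<and>
    l < card (A \<inter> ?R) \<and> l < card (B \<inter> ?R)}"
  obtain A B where AB: "(A, B) \<in> F" "\<And>C D. (C, D) \<in> edge_seps y \<Longrightarrow> uncrossed A B C D"
  proof (rule exists_uncrossed[of F y l])
    have "card (S \<inter> X) \<le> card (S \<inter> ?R)" for S using XR fR by (intro card_mono) auto
    then have "(A0, B0) \<in> F"
      using AB0 unfolding F_def l_def separations_below_iff by (auto intro: less_le_trans)
    then show "F \<noteq> {}" by blast
    show "finite (verts_of y)" using fin yv by simp
    show "(B, A) \<in> F" if "(A, B) \<in> F" for A B
      using that separations_swap[of A B G] by (auto simp: F_def Int_commute)
    show "A \<union> B \<subseteq> verts_of y \<and> card (A \<inter> B) \<le> l" if "(A, B) \<in> F" for A B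
      using that yv separations_Un[of A B G] by (simp add: F_def)
    show "(A \<union> C, B \<inter> D) \<in> F"
      if F: "(A, B) \<in> F" and CD: "(C, D) \<in> edge_seps y" and le: "card ((A \<union> C) \<inter> (B \<inter> D)) \<le> l" for A B C D
    proof -
      have "(A \<union> C, B \<inter> D) \<in> separations G"
        using separations_corner decomposes_edge_seps[OF yd CD] F by (auto simp: F_def)
      moreover have "card (A \<inter> ?R) \<le> card ((A \<union> C) \<inter> ?R)" using fR by (intro card_mono) auto
      moreover have "B \<inter> D \<inter> ?R = B \<inter> ?R" using root_part_subset_edge_sep[OF CD] by blast
      ultimately show ?thesis using F le by (simp add: F_def)
    qed
    \<comment> \<open>Below an edge, \<open>A\<close> meets the root part only inside
      \<open>A \<inter> B\<close>, which is too few vertices.\<close>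
    show "\<not> (A \<subseteq> C \<and> D \<subseteq> B)" if F: "(A, B) \<in> F" and CD: "(C, D) \<in> edge_seps y" for A B C D
    proof
      assume "A \<subseteq> C \<and> D \<subseteq> B"
      then have "A \<inter> ?R \<subseteq> A \<inter> B" using root_part_subset_edge_sep[OF CD] by blast
      moreover have "finite (A \<inter> B)" using F fin separations_Un[of A B G] by (auto simp: F_def intro: finite_subset)
      ultimately have "card (A \<inter> ?R) \<le> card (A \<inter> B)" by (intro card_mono)
      with F show False by (simp add: F_def)
    qed
  qed (use that in blast)
  have "l < k" using AB0 by (simp add: l_def separations_below_iff)
  have F: "(A, B) \<in> separations G" "card (A \<inter> B) \<le> l" "l < card (A \<inter> ?R)" "l < card (B \<inter> ?R)"
    using AB(1) by (auto simp: F_def)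
  show thesis
    by (rule that[OF y(1) _ XR _ _ AB(2)]) (use F \<open>l < k\<close> in \<open>simp_all add: separations_below_iff\<close>)
qed

lemma exists_lean_tree:
  fixes G :: "('a, 'b) pre_digraph"
  assumes fin: "finite (verts G)" and wf: "wf_digraph G"
  obtains x where "decomposes G x" "adhesion_below x k"
    "\<And>P Q. regular_profile G k P \<Longrightarrow> regular_profile G k Q \<Longrightarrow> distinguishable_below k P Q \<Longrightarrow>
      tree_distinguishes x P Q"
    "\<And>X. X \<in> parts x \<Longrightarrow> k \<le> card X \<Longrightarrow> lean_part G k X"
proof -
  define good where "good = (\<lambda>x. decomposes G x \<and> adhesion_below x k \<and>
    (\<forall>P Q. regular_profile G k P \<longrightarrow> regular_profile G k Q \<longrightarrow> distinguishable_below k P Q \<longrightarrow>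
      tree_distinguishes x P Q))"
  obtain x0 where "good x0"
    using exists_distinguishing_tree[OF fin wf order_refl] unfolding good_def by blast
  then obtain x where x: "good x"
    and least: "\<And>y. good y \<Longrightarrow> weight (part_weight k) x \<le> weight (part_weight k) y"
    using ex_has_least_nat[of good x0 "weight (part_weight k)"] by blast
  have "lean_part G k X" if X: "X \<in> parts x" "k \<le> card X" for X
  proof (rule ccontr)
    assume n: "\<not> lean_part G k X"
    have xd: "decomposes G x" "adhesion_below x k" using x by (auto simp: good_def)
    obtain y A B where y: "tree_equiv y x" and ABk: "(A, B) \<in> separations_below G k"
      and R: "X \<subseteq> root_part y"
        "card (A \<inter> B) < card (A \<inter> root_part y)" "card (A \<inter> B) < card (B \<inter> root_part y)"
      and unc: "\<And>C D. (C, D) \<in> edge_seps y \<Longrightarrow> uncrossed A B C D"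
      using exists_uncrossed_split[OF fin xd(1) X(1) n] by metis
    have AB: "(A, B) \<in> separations G" "card (A \<inter> B) < k" using ABk by (auto simp: separations_below_iff)
    have yd: "decomposes G y" "adhesion_below y k"
      using y xd tree_equiv_decomposes tree_equiv_adhesion_below by blast+
    have yv: "verts_of y = verts G" "coherent y" using yd by (auto simp: decomposes_def)
    let ?z = "split_tree A B y"
    have keep: "tree_distinguishes ?z P' Q'"
      if "regular_profile G k P'" "regular_profile G k Q'" "tree_distinguishes x P' Q'" for P' Q'
      using tree_distinguishes_split_tree[OF fin yd ABk unc that(1,2)]
        tree_equiv_distinguishes[OF tree_equiv_sym[OF y] that(3)] by blast
    have "adhesion_below ?z k"
      by (rule adhesion_below_split_tree[OF fin yd(1) AB yd(2) unc])
    then have "good ?z"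
      using x keep decomposes_split_tree[OF yd(1) AB(1)] by (auto simp: good_def)
    moreover have "k \<le> card (root_part y)"
      using X(2) R(1) fin yv root_part_subset[of y] by (metis card_mono finite_subset order_trans)
    then have "weight (part_weight k) ?z < weight (part_weight k) y"
      using AB R unc fin yv separations_Un[OF AB(1)] by (intro weight_split_tree_less) auto
    moreover have "weight (part_weight k) y = weight (part_weight k) x"
      using y by (simp add: tree_equiv_def)
    ultimately show False using least by fastforce
  qed
  with x that show thesis unfolding good_def by blast
qed

section \<open>Trees given by parent pointers\<close>

text \<open>An edge is indexed by its lower end, and \<open>M\<close> lists the edges that are
  present. Deleting an edge of the tree thus means removing one index from \<open>M\<close>.\<close>

definition parent_graph :: "nat \<Rightarrow> (nat \<Rightarrow> nat) \<Rightarrow> nat set \<Rightarrow> (nat, nat \<times> nat) pre_digraph" where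
  "parent_graph N p M =
     \<lparr>verts = {..<N}, arcs = (\<lambda>m. (m, p m)) ` M \<union> (\<lambda>m. (p m, m)) ` M, tail = fst, head = snd\<rparr>"

text \<open>\<open>L n\<close> is the set of descendants of \<open>n\<close>, including \<open>n\<close>.\<close>

locale parent_array =
  fixes N :: nat and p :: "nat \<Rightarrow> nat" and L :: "nat \<Rightarrow> nat set"
  assumes N_pos: "0 < N"
    and parent_less: "0 < n \<Longrightarrow> n < N \<Longrightarrow> p n < n"
    and self_desc: "0 < n \<Longrightarrow> n < N \<Longrightarrow> n \<in> L n"
    and parent_not_desc: "0 < n \<Longrightarrow> n < N \<Longrightarrow> p n \<notin> L n"
    and zero_not_desc: "0 < n \<Longrightarrow> n < N \<Longrightarrow> 0 \<notin> L n"
    and desc_bound: "0 < n \<Longrightarrow> n < N \<Longrightarrow> L n \<subseteq> {..<N}"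
    and desc_parent_iff:
      "0 < n \<Longrightarrow> n < N \<Longrightarrow> 0 < m \<Longrightarrow> m < N \<Longrightarrow> m \<noteq> n \<Longrightarrow> p m \<in> L n \<longleftrightarrow> m \<in> L n"
begin

abbreviation T :: "(nat, nat \<times> nat) pre_digraph" where
  "T \<equiv> parent_graph N p {0<..<N}"

lemma parent_graph_simps [simp]:
  "verts (parent_graph N p M) = {..<N}" "tail (parent_graph N p M) = fst"
  "head (parent_graph N p M) = snd"
  by (simp_all add: parent_graph_def)

lemma in_arcs_parent_graph:
  "e \<in> arcs (parent_graph N p M) \<longleftrightarrow> (\<exists>m\<in>M. e = (m, p m) \<or> e = (p m, m))"
  by (auto simp: parent_graph_def)

lemma parent_graph_arcE:
  assumes "e \<in> arcs (parent_graph N p M)" "M \<subseteq> {0<..<N}"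
  obtains m where "m \<in> M" "0 < m" "m < N" "e = (m, p m) \<or> e = (p m, m)"
proof -
  obtain m where "m \<in> M" "e = (m, p m) \<or> e = (p m, m)"
    using assms(1) unfolding in_arcs_parent_graph by blast
  moreover from this assms(2) have "0 < m" "m < N" by auto
  ultimately show thesis using that by blast
qed

lemma arcs_ends_parent_graph: "arcs_ends (parent_graph N p M) = arcs (parent_graph N p M)"
  by (simp add: arcs_ends_conv)

lemma symmetric_parent_graph: "symmetric (parent_graph N p M)"
  unfolding symmetric_def arcs_ends_parent_graph by (auto simp: sym_def in_arcs_parent_graph)

lemma wf_parent_graph: "M \<subseteq> {0<..<N} \<Longrightarrow> wf_digraph (parent_graph N p M)"
proof
  fix e assume "M \<subseteq> {0<..<N}" "e \<in> arcs (parent_graph N p M)"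
  then obtain m where m: "0 < m" "m < N" "e = (m, p m) \<or> e = (p m, m)"
    using parent_graph_arcE by metis
  then show "tail (parent_graph N p M) e \<in> verts (parent_graph N p M)"
    and "head (parent_graph N p M) e \<in> verts (parent_graph N p M)"
    using parent_less[OF m(1,2)] by auto
qed

lemma graph_T: "graph T"
proof -
  interpret wf_digraph T by (rule wf_parent_graph) simp
  have "digraph T"
  proof
    show "finite (verts T)" "finite (arcs T)" by (simp_all add: parent_graph_def)
    show "tail T e \<noteq> head T e" if e: "e \<in> arcs T" for e
    proof -
      obtain m where m: "0 < m" "m < N" "e = (m, p m) \<or> e = (p m, m)"
        using e by (rule parent_graph_arcE) simp
      then show ?thesis using parent_less[OF m(1,2)] by auto
    qed
    show "e1 = e2" if "arc_to_ends T e1 = arc_to_ends T e2" for e1 e2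
      using that by (simp add: arc_to_ends_def prod_eq_iff)
  qed
  then show ?thesis using symmetric_parent_graph by (rule digraph.graphI)
qed

lemma delete_edge_T:
  assumes "0 < n" "n < N"
  shows "delete_edge T n (p n) = parent_graph N p ({0<..<N} - {n})"
    and "delete_edge T (p n) n = parent_graph N p ({0<..<N} - {n})"
proof -
  \<comment> \<open>Parents have smaller numbers, so an edge determines its lower end as the larger
    of its two ends.\<close>
  have eq: "{m, p m} = {n, p n} \<longleftrightarrow> m = n" if "0 < m" "m < N" for m
    using parent_less[OF that] parent_less[OF assms] by (auto simp: doubleton_eq_iff)
  have "{e \<in> arcs T. {fst e, snd e} \<noteq> {n, p n}} = arcs (parent_graph N p ({0<..<N} - {n}))"
  proof (rule set_eqI)
    fix e
    have "{fst e, snd e} = {m, p m}" if "e = (m, p m) \<or> e = (p m, m)" for m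
      using that by auto
    then show "e \<in> {e \<in> arcs T. {fst e, snd e} \<noteq> {n, p n}} \<longleftrightarrow>
        e \<in> arcs (parent_graph N p ({0<..<N} - {n}))"
      unfolding mem_Collect_eq in_arcs_parent_graph
      by (metis Diff_iff eq greaterThanLessThan_iff singletonD singletonI)
  qed
  then show "delete_edge T n (p n) = parent_graph N p ({0<..<N} - {n})"
    and "delete_edge T (p n) n = parent_graph N p ({0<..<N} - {n})"
    by (simp_all add: delete_edge_def insert_commute parent_graph_def)
qed

text \<open>Only the deleted edge leaves \<open>L n\<close>, by \<open>desc_parent_iff\<close>.
  Conversely, climbing through parents from a descendant stays in \<open>L n\<close> and strictly
  decreases the number, so it ends at \<open>n\<close>.\<close>

lemma reach_desc:
  assumes n: "0 < n" "n < N"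
  shows "{t. n \<rightarrow>\<^sup>*\<^bsub>parent_graph N p ({0<..<N} - {n})\<^esub> t} = L n"
proof -
  let ?D = "parent_graph N p ({0<..<N} - {n})"
  interpret D: wf_digraph ?D by (rule wf_parent_graph) auto
  have "t \<in> L n" if "n \<rightarrow>\<^sup>*\<^bsub>?D\<^esub> t" for t
    using reachable_rtranclI[OF that]
  proof (induction rule: rtrancl_induct)
    case base
    then show ?case using self_desc n by blast
  next
    case (step y z)
    from step(2) obtain m where m: "m \<in> {0<..<N} - {n}" "(y, z) = (m, p m) \<or> (y, z) = (p m, m)"
      unfolding arcs_ends_parent_graph in_arcs_parent_graph by blast
    with step.IH show ?case using desc_parent_iff[OF n, of m] by auto
  qed
  moreover have "n \<rightarrow>\<^sup>*\<^bsub>?D\<^esub> m" if "m \<in> L n" for m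
    using that
  proof (induction m rule: less_induct)
    case (less m)
    have m: "0 < m" "m < N"
      using less.prems zero_not_desc[OF n] desc_bound[OF n] by (auto intro: gr0I)
    show ?case
    proof (cases "m = n")
      case True
      then show ?thesis using m by auto
    next
      case False
      then have "n \<rightarrow>\<^sup>*\<^bsub>?D\<^esub> p m"
        using less.IH[OF parent_less[OF m]] desc_parent_iff[OF n m] less.prems by blast
      moreover have "(p m, m) \<in> arcs_ends ?D"
        using m False by (auto simp: arcs_ends_parent_graph in_arcs_parent_graph)
      ultimately show ?thesis by (rule D.reachable_adj_trans)
    qed
  qed
  ultimately show ?thesis by blast
qed

text \<open>\<open>S\<close> is closed under parents and all edges to these parents are present, so
  climbing from \<open>m\<close> leads to the root.\<close>

lemma zero_reach:
  assumes "M \<subseteq> {0<..<N}" "m < N"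
    and "\<And>j. 0 < j \<Longrightarrow> j < N \<Longrightarrow> j \<in> S \<Longrightarrow> j \<in> M \<and> p j \<in> S" "m \<in> S"
  shows "0 \<rightarrow>\<^sup>*\<^bsub>parent_graph N p M\<^esub> m"
proof -
  interpret D: wf_digraph "parent_graph N p M" by (rule wf_parent_graph[OF assms(1)])
  show ?thesis using assms(2,4)
  proof (induction m rule: less_induct)
    case (less m)
    show ?case
    proof (cases "m = 0")
      case True
      then show ?thesis using N_pos by auto
    next
      case False
      then have m: "0 < m" "m < N" using less.prems by auto
      have M: "m \<in> M" "p m \<in> S" using assms(3)[OF m less.prems(2)] by auto
      then have "0 \<rightarrow>\<^sup>*\<^bsub>parent_graph N p M\<^esub> p m"
        using less.IH[OF parent_less[OF m]] parent_less[OF m] m by simp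
      moreover have "(p m, m) \<in> arcs_ends (parent_graph N p M)"
        using M by (auto simp: arcs_ends_parent_graph in_arcs_parent_graph)
      ultimately show ?thesis by (rule D.reachable_adj_trans)
    qed
  qed
qed

text \<open>The complement of \<open>L n\<close> is closed under parents, so each of its vertices,
  \<open>p n\<close> included, remains connected to the root 0.\<close>

lemma reach_not_desc:
  assumes n: "0 < n" "n < N"
  shows "{t. p n \<rightarrow>\<^sup>*\<^bsub>parent_graph N p ({0<..<N} - {n})\<^esub> t} = {..<N} - L n"
proof -
  let ?D = "parent_graph N p ({0<..<N} - {n})"
  interpret D: wf_digraph ?D by (rule wf_parent_graph) auto
  have sub: "t \<notin> L n \<and> t < N" if "p n \<rightarrow>\<^sup>*\<^bsub>?D\<^esub> t" for t
    using reachable_rtranclI[OF that]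
  proof (induction rule: rtrancl_induct)
    case base
    then show ?case using parent_not_desc[OF n] parent_less[OF n] n by simp
  next
    case (step y z)
    from step(2) obtain m where "m \<in> {0<..<N} - {n}" "(y, z) = (m, p m) \<or> (y, z) = (p m, m)"
      unfolding arcs_ends_parent_graph in_arcs_parent_graph by blast
    then have m: "0 < m" "m < N" "m \<noteq> n" "y = m \<and> z = p m \<or> y = p m \<and> z = m" by auto
    then show ?case using step.IH desc_parent_iff[OF n m(1-3)] parent_less[OF m(1,2)] by auto
  qed
  have zero: "0 \<rightarrow>\<^sup>*\<^bsub>?D\<^esub> m" if "m < N" "m \<notin> L n" for m
  proof (rule zero_reach[where S = "- L n"])
    show "j \<in> {0<..<N} - {n} \<and> p j \<in> - L n" if "0 < j" "j < N" "j \<in> - L n" for j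
      using that desc_parent_iff[OF n, of j] self_desc[OF n] by auto
  qed (use that in auto)
  have pn: "p n \<rightarrow>\<^sup>*\<^bsub>?D\<^esub> 0"
    by (rule symmetric_reachable[OF symmetric_parent_graph], rule zero)
      (use parent_not_desc[OF n] parent_less[OF n] n in simp_all)
  have sup: "p n \<rightarrow>\<^sup>*\<^bsub>?D\<^esub> m" if "m < N" "m \<notin> L n" for m
    using pn zero[OF that] by (rule D.reachable_trans)
  show ?thesis
  proof (rule set_eqI)
    fix t
    show "t \<in> {t. p n \<rightarrow>\<^sup>*\<^bsub>?D\<^esub> t} \<longleftrightarrow> t \<in> {..<N} - L n"
      using sub[of t] sup[of t] by (simp, metis)
  qed
qed

lemma edge_separation_T:
  assumes "0 < n" "n < N"
  shows "edge_separation T V n (p n) = (\<Union>(V ` L n), \<Union>(V ` ({..<N} - L n)))"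
    and "edge_separation T V (p n) n = (\<Union>(V ` ({..<N} - L n)), \<Union>(V ` L n))"
  unfolding edge_separation_def delete_edge_T[OF assms] reach_desc[OF assms] reach_not_desc[OF assms]
  by simp_all

section \<open>Connectedness, absence of cycles, and paths in the tree\<close>

lemma connected_T: "connected T"
proof -
  interpret wf_digraph T by (rule wf_parent_graph) simp
  have zero: "0 \<rightarrow>\<^sup>*\<^bsub>T\<^esub> m" if "m < N" for m
    by (rule zero_reach[where S = UNIV]) (use that in auto)
  have "u \<rightarrow>\<^sup>*\<^bsub>T\<^esub> v" if "u < N" "v < N" for u v
    using symmetric_reachable[OF symmetric_parent_graph zero[OF that(1)]] zero[OF that(2)]
    by (rule reachable_trans)
  then show ?thesis
    using N_pos by (auto simp: connected_def strongly_connected_def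
        reachable_mk_symmetric_eq[OF symmetric_parent_graph] lessThan_empty_iff)
qed

text \<open>A walk changes sides of an edge only by traversing that edge.\<close>

lemma cas_desc_iff:
  assumes n: "0 < n" "n < N" and "set q \<subseteq> arcs T" "pre_digraph.cas T a q b"
    and "(n, p n) \<notin> set q" "(p n, n) \<notin> set q"
  shows "a \<in> L n \<longleftrightarrow> b \<in> L n"
  using assms(3-)
proof (induction q arbitrary: a)
  case Nil
  then show ?case by (simp add: pre_digraph.cas.simps)
next
  case (Cons e q)
  obtain m where m: "0 < m" "m < N" "e = (m, p m) \<or> e = (p m, m)"
    using Cons.prems(1) parent_graph_arcE[of e "{0<..<N}"] by auto
  then have "m \<noteq> n" using Cons.prems(3,4) by auto
  then have "fst e \<in> L n \<longleftrightarrow> snd e \<in> L n" using m desc_parent_iff[OF n m(1,2)] by auto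
  moreover have "fst e = a" "pre_digraph.cas T (snd e) q b"
    using Cons.prems(2) by (simp_all add: pre_digraph.cas.simps)
  ultimately show ?case using Cons.IH[of "snd e"] Cons.prems by simp
qed

lemma awalk_verts_split:
  "pre_digraph.awalk_verts T a (q @ f # r) = map fst q @ fst f # pre_digraph.awalk_verts T (snd f) r"
  by (induction q arbitrary: a) (simp_all add: pre_digraph.awalk_verts.simps)

lemma cas_split:
  "pre_digraph.cas T a (q @ r) b \<longleftrightarrow> (\<exists>c. pre_digraph.cas T a q c \<and> pre_digraph.cas T c r b)"
  by (induction q arbitrary: a) (simp_all add: pre_digraph.cas.simps)

lemma last_in_awalk_verts: "pre_digraph.cas T a q b \<Longrightarrow> b \<in> set (pre_digraph.awalk_verts T a q)"
  by (induction q arbitrary: a) (simp_all add: pre_digraph.cas.simps pre_digraph.awalk_verts.simps)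

lemma first_in_awalk_verts: "pre_digraph.cas T a q b \<Longrightarrow> a \<in> set (pre_digraph.awalk_verts T a q)"
  by (cases q) (simp_all add: pre_digraph.cas.simps pre_digraph.awalk_verts.simps)

lemma arc_ends_in_awalk_verts:
  assumes "pre_digraph.cas T a q b" "f \<in> set q"
  shows "fst f \<in> set (pre_digraph.awalk_verts T a q)" "snd f \<in> set (pre_digraph.awalk_verts T a q)"
proof -
  obtain q1 q2 where q: "q = q1 @ f # q2" using assms(2) by (meson split_list)
  then have "pre_digraph.cas T (snd f) q2 b"
    using assms(1) by (auto simp: cas_split pre_digraph.cas.simps)
  from first_in_awalk_verts[OF this]
  show "fst f \<in> set (pre_digraph.awalk_verts T a q)" "snd f \<in> set (pre_digraph.awalk_verts T a q)"
    unfolding q awalk_verts_split by simp_all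
qed

text \<open>The rest \<open>q\<close> of the cycle returns across the first edge \<open>e\<close>,
  so it uses \<open>e\<close> or its reverse. Using \<open>e\<close> again repeats its tail; the
  reverse starts and ends where \<open>q\<close> does, so \<open>q\<close> would be that single
  arc.\<close>

lemma no_long_cycle: "pre_digraph.cycle T c \<Longrightarrow> length c < 3"
proof (rule ccontr)
  assume "pre_digraph.cycle T c" "\<not> length c < 3"
  then obtain u e q where c: "c = e # q" and walk: "set c \<subseteq> arcs T" "pre_digraph.cas T u c u"
    and dist: "distinct (tl (pre_digraph.awalk_verts T u c))"
    unfolding pre_digraph.cycle_def pre_digraph.awalk_def by (metis list.exhaust)
  have dist': "distinct (pre_digraph.awalk_verts T (snd e) q)"
    using dist c by (simp add: pre_digraph.awalk_verts.simps)
  have e: "fst e = u" "pre_digraph.cas T (snd e) q u"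
    using walk(2) c by (simp_all add: pre_digraph.cas.simps)
  have len: "2 \<le> length q" using \<open>\<not> length c < 3\<close> c by simp
  obtain n where n: "0 < n" "n < N" "e = (n, p n) \<or> e = (p n, n)"
    using walk(1) c parent_graph_arcE[of e "{0<..<N}"] by auto
  have sides: "fst e \<in> L n \<longleftrightarrow> snd e \<notin> L n"
    using n self_desc[OF n(1,2)] parent_not_desc[OF n(1,2)] by auto
  have "f \<notin> set q" if f: "f = (snd e, fst e) \<or> f = e" for f
  proof
    assume "f \<in> set q"
    then obtain q1 q2 where q: "q = q1 @ f # q2" by (meson split_list)
    have d: "distinct (map fst q1 @ fst f # pre_digraph.awalk_verts T (snd f) q2)"
      using dist' unfolding q awalk_verts_split .
    have cas2: "pre_digraph.cas T (snd f) q2 u" and cas1: "pre_digraph.cas T (snd e) q1 (fst f)"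
      using e(2) unfolding q by (auto simp: cas_split pre_digraph.cas.simps)
    show False
    proof (cases "f = e")
      case True
      then show False using last_in_awalk_verts[OF cas2] d e(1) by auto
    next
      case False
      then have f': "fst f = snd e" "snd f = u" using f e(1) by auto
      have "q1 = []" using cas1 d f' by (cases q1) (auto simp: pre_digraph.cas.simps)
      moreover have "q2 = []"
      proof (cases q2)
        case (Cons g r)
        then have "fst g = u" "pre_digraph.cas T (snd g) r u"
          using cas2 f' by (auto simp: pre_digraph.cas.simps)
        then show ?thesis using d last_in_awalk_verts[of "snd g" r u] Cons
          by (auto simp: pre_digraph.awalk_verts.simps)
      qed
      ultimately show False using len q by simp
    qed
  qed
  then have "(n, p n) \<notin> set q" "(p n, n) \<notin> set q" using n(3) by auto
  from cas_desc_iff[OF n(1,2) _ e(2) this] have "snd e \<in> L n \<longleftrightarrow> u \<in> L n" using walk(1) c by simp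
  with sides e(1) show False by blast
qed

lemma undirected_tree_T: "undirected_tree T"
  using graph_T connected_T no_long_cycle by (auto simp: undirected_tree_def not_le[symmetric])

text \<open>The path enters \<open>t2\<close> through an arc \<open>f\<close> and traverses that
  edge only once. Hence \<open>t1\<close> and \<open>t3\<close> lie on different sides of it, and
  the common vertices of their parts lie in both end parts of \<open>f\<close>, one of which is
  \<open>V t2\<close>.\<close>

lemma apath_part_subset:
  assumes V: "\<And>n. 0 < n \<Longrightarrow> n < N \<Longrightarrow> \<Union>(V ` L n) \<inter> \<Union>(V ` ({..<N} - L n)) \<subseteq> V n \<inter> V (p n)"
    and path: "pre_digraph.apath T t1 q t3" and t2: "t2 \<in> set (pre_digraph.awalk_verts T t1 q)"
  shows "V t1 \<inter> V t3 \<subseteq> V t2"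
proof (cases "t2 = t1")
  case False
  have walk: "t1 < N" "set q \<subseteq> arcs T" "pre_digraph.cas T t1 q t3"
    and dist: "distinct (pre_digraph.awalk_verts T t1 q)"
    using path by (auto simp: pre_digraph.apath_def pre_digraph.awalk_def)
  interpret wf_digraph T by (rule wf_parent_graph) simp
  have "t2 \<in> snd ` set q"
  proof -
    have "q \<noteq> []" using t2 False by (auto simp: pre_digraph.awalk_verts.simps)
    moreover have "fst (hd q) = t1" using walk(3) \<open>q \<noteq> []\<close>
      by (cases q) (auto simp: pre_digraph.cas.simps)
    ultimately show ?thesis using awalk_verts_conv'[OF walk(3)] t2 False by auto
  qed
  then obtain f where f: "f \<in> set q" "snd f = t2" by auto
  then obtain q1 q2 where q: "q = q1 @ f # q2" by (meson split_list)
  have d: "distinct (map fst q1 @ fst f # pre_digraph.awalk_verts T t2 q2)"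
    using dist f(2) unfolding q awalk_verts_split by simp
  have cas2: "pre_digraph.cas T t2 q2 t3" and cas1: "pre_digraph.cas T t1 q1 (fst f)"
    using walk(3) f(2) unfolding q by (auto simp: cas_split pre_digraph.cas.simps)
  obtain n where n: "0 < n" "n < N" "f = (n, p n) \<or> f = (p n, n)"
    using subsetD[OF walk(2) f(1)] by (rule parent_graph_arcE) simp
  have f': "f = (fst f, t2)" using f(2) by (cases f) simp
  have "t2 \<in> set (pre_digraph.awalk_verts T t2 q2)" using first_in_awalk_verts[OF cas2] .
  then have q1: "t2 \<notin> fst ` set q1" using d by auto
  have t2f: "fst f \<noteq> t2" using d \<open>t2 \<in> set (pre_digraph.awalk_verts T t2 q2)\<close> by auto
  have a1: "g \<notin> set q1" if g: "g = f \<or> g = (t2, fst f)" for g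
    using g d q1 by (force simp: image_iff)
  have a2: "g \<notin> set q2" if g: "g = f \<or> g = (t2, fst f)" for g
    using g d arc_ends_in_awalk_verts[OF cas2, of g] by auto
  have "(n, p n) = f \<or> (n, p n) = (t2, fst f)" "(p n, n) = f \<or> (p n, n) = (t2, fst f)"
    using n(3) f' by (metis fst_conv snd_conv)+
  then have "t1 \<in> L n \<longleftrightarrow> fst f \<in> L n" "t2 \<in> L n \<longleftrightarrow> t3 \<in> L n"
    using cas_desc_iff[OF n(1,2) _ cas1] cas_desc_iff[OF n(1,2) _ cas2] a1 a2 walk(2) q by auto
  moreover have "fst f \<in> L n \<longleftrightarrow> t2 \<notin> L n"
    using n self_desc[OF n(1,2)] parent_not_desc[OF n(1,2)] f(2) by auto
  moreover have "t1 < N" "t3 < N"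
    using walk last_in_awalk_verts[OF walk(3)] awalk_verts_in_verts[of t1 q t3] by auto
  ultimately have "V t1 \<inter> V t3 \<subseteq> \<Union>(V ` L n) \<inter> \<Union>(V ` ({..<N} - L n))" by blast
  also have "\<dots> \<subseteq> V n \<inter> V (p n)" using V n by blast
  also have "\<dots> \<subseteq> V t2" using n(3) f(2) by auto
  finally show ?thesis .
qed blast

end

section \<open>Parent arrays that carry the data of a part tree\<close>

definition represents ::
  "nat \<Rightarrow> (nat \<Rightarrow> nat) \<Rightarrow> (nat \<Rightarrow> nat set) \<Rightarrow> (nat \<Rightarrow> 'a set) \<Rightarrow> 'a part_tree \<Rightarrow> bool" where
  "represents N p L V x \<longleftrightarrow> parent_array N p L \<and> V 0 = root_part x \<and> V ` {..<N} = parts x \<and>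
     edge_seps x = (\<lambda>n. (\<Union>(V ` L n), \<Union>(V ` ({..<N} - L n)))) ` {0<..<N} \<and>
     (coherent x \<longrightarrow>
       (\<forall>n\<in>{0<..<N}. \<Union>(V ` L n) \<inter> \<Union>(V ` ({..<N} - L n)) \<subseteq> V n \<inter> V (p n)))"

text \<open>The vertices of \<open>b\<close> are shifted by \<open>Na\<close>. The old root of
  \<open>b\<close> acquires a parent, so its descendant set is the whole shifted block; all other
  descendant sets are merely copied or shifted.\<close>

lemma represents_Attach:
  assumes a: "represents Na pa La Va a" and b: "represents Nb pb Lb Vb b"
  defines "p \<equiv> \<lambda>n. if n < Na then pa n else if n = Na then 0 else Na + pb (n - Na)"
    and "L \<equiv> \<lambda>n. if n < Na then La n else if n = Na then {Na..<Na + Nb} else (+) Na ` Lb (n - Na)"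
    and "V \<equiv> \<lambda>n. if n < Na then Va n else Vb (n - Na)"
  shows "represents (Na + Nb) p L V (Attach a b)"
proof -
  interpret A: parent_array Na pa La using a by (simp add: represents_def)
  interpret B: parent_array Nb pb Lb using b by (simp add: represents_def)
  have La: "La n \<subseteq> {..<Na}" if "0 < n" "n < Na" for n using A.desc_bound that by blast
  have Lb: "Lb n \<subseteq> {..<Nb}" if "0 < n" "n < Nb" for n using B.desc_bound that by blast
  have pos: "0 < Na" "0 < Nb" using A.N_pos B.N_pos .
  have cases: thesis if "n < Na + Nb"
    "n < Na \<Longrightarrow> thesis" "n = Na \<Longrightarrow> thesis" "\<And>j. 0 < j \<Longrightarrow> j < Nb \<Longrightarrow> n = Na + j \<Longrightarrow> thesis" for n thesis
  proof -
    consider "n < Na" | "n = Na" | "Na < n" by linarith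
    then show thesis
    proof cases
      case 3
      then have "0 < n - Na" "n - Na < Nb" "n = Na + (n - Na)" using that(1) by linarith+
      then show thesis by (rule that(4))
    qed (use that in blast)+
  qed
  have array: "parent_array (Na + Nb) p L"
  proof
    show "0 < Na + Nb" using pos by simp
    fix n assume n: "0 < n" "n < Na + Nb"
    have "p n < n \<and> n \<in> L n \<and> p n \<notin> L n \<and> 0 \<notin> L n \<and> L n \<subseteq> {..<Na + Nb}"
    proof (rule cases[OF n(2)])
      assume "n < Na"
      then show ?thesis
        using A.parent_less[of n] A.self_desc[of n] A.parent_not_desc[of n] A.zero_not_desc[of n]
          La[of n] n(1)
        by (simp add: p_def L_def) (meson lessThan_subset_iff le_add1 order_trans)
    next
      assume "n = Na"
      then show ?thesis using pos by (simp add: p_def L_def subset_iff)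
    next
      fix j assume j: "0 < j" "j < Nb" "n = Na + j"
      then show ?thesis
        using B.parent_less[OF j(1,2)] B.self_desc[OF j(1,2)] B.parent_not_desc[OF j(1,2)]
          B.zero_not_desc[OF j(1,2)] Lb[OF j(1,2)] pos
        by (auto simp: p_def L_def)
    qed
    then show "p n < n" "n \<in> L n" "p n \<notin> L n" "0 \<notin> L n" "L n \<subseteq> {..<Na + Nb}" by blast+
    fix m assume m: "0 < m" "m < Na + Nb" "m \<noteq> n"
    show "p m \<in> L n \<longleftrightarrow> m \<in> L n"
    proof (rule cases[OF n(2)])
      assume n': "n < Na"
      note bound = La[OF n(1) n']
      show ?thesis
      proof (rule cases[OF m(2)])
        assume "m < Na"
        then show ?thesis
          using n' A.desc_parent_iff[OF n(1) n' m(1) _ m(3)] by (simp add: p_def L_def)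
      next
        assume "m = Na"
        then show ?thesis
          using n' bound A.zero_not_desc[OF n(1) n'] by (auto simp: p_def L_def)
      next
        fix i assume "0 < i" "i < Nb" "m = Na + i"
        then show ?thesis using n' bound by (auto simp: p_def L_def)
      qed
    next
      assume n': "n = Na"
      show ?thesis
      proof (rule cases[OF m(2)])
        assume "m < Na"
        then show ?thesis using n' A.parent_less[OF m(1)] by (simp add: p_def L_def)
      next
        assume "m = Na"
        then show ?thesis using n' m(3) by simp
      next
        fix i assume i: "0 < i" "i < Nb" "m = Na + i"
        then show ?thesis using n' B.parent_less[OF i(1,2)] by (simp add: p_def L_def)
      qed
    next
      fix j assume j: "0 < j" "j < Nb" "n = Na + j"
      show ?thesis
      proof (rule cases[OF m(2)])
        assume "m < Na"
        then show ?thesis using j A.parent_less[of m] m by (auto simp: p_def L_def)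
      next
        assume "m = Na"
        then show ?thesis using j pos B.zero_not_desc[OF j(1,2)] by (auto simp: p_def L_def)
      next
        fix i assume "0 < i" "i < Nb" "m = Na + i"
        then show ?thesis using j m B.desc_parent_iff[OF j(1,2), of i] by (auto simp: p_def L_def)
      qed
    qed
  qed
  have root: "V 0 = root_part (Attach a b)" using a pos by (simp add: represents_def V_def)
  have Va: "V ` S = Va ` S" if "S \<subseteq> {..<Na}" for S
    by (rule image_cong) (use that in \<open>auto simp: V_def\<close>)
  have Vb: "V ` (+) Na ` S = Vb ` S" for S
    unfolding image_image by (rule image_cong) (auto simp: V_def)
  have shift: "(+) Na ` {..<Nb} = {Na..<Na + Nb}" by (simp add: lessThan_atLeast0 add.commute)
  have split: "{..<Na + Nb} = {..<Na} \<union> (+) Na ` {..<Nb}"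
    unfolding shift by auto
  have "(+) Na ` {0<..<Nb} = {Na<..<Na + Nb}"
    by (simp add: atLeastSucLessThan_greaterThanLessThan[symmetric] add.commute)
  then have split_pos: "{0<..<Na + Nb} = {0<..<Na} \<union> (+) Na ` {0<..<Nb} \<union> {Na}"
    using pos by auto
  have pa: "Va ` {..<Na} = parts a" and pb: "Vb ` {..<Nb} = parts b"
    using a b by (simp_all add: represents_def)
  have parts: "V ` {..<Na + Nb} = parts (Attach a b)"
    by (simp add: split image_Un Va Vb pa pb)
  have Ua: "\<Union>(Va ` {..<Na}) = verts_of a" and Ub: "\<Union>(Vb ` {..<Nb}) = verts_of b"
    by (simp_all add: pa pb Union_parts)
  let ?C = "\<lambda>n. \<Union>(V ` L n)" and ?D = "\<lambda>n. \<Union>(V ` ({..<Na + Nb} - L n))"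
  let ?Ca = "\<lambda>n. \<Union>(Va ` La n)" and ?Da = "\<lambda>n. \<Union>(Va ` ({..<Na} - La n))"
  let ?Cb = "\<lambda>n. \<Union>(Vb ` Lb n)" and ?Db = "\<lambda>n. \<Union>(Vb ` ({..<Nb} - Lb n))"
  have e1: "?C n = ?Ca n \<and> ?D n = ?Da n \<union> verts_of b" if n: "0 < n" "n < Na" for n
  proof -
    have "L n = La n" using n by (simp add: L_def)
    moreover have "{..<Na + Nb} - La n = ({..<Na} - La n) \<union> (+) Na ` {..<Nb}"
      unfolding split using La[OF n] by auto
    ultimately show ?thesis using Va[OF La[OF n]] Va[of "{..<Na} - La n"] by (simp add: image_Un Vb Ub)
  qed
  have e2: "?C Na = verts_of b \<and> ?D Na = verts_of a"
  proof -
    have "L Na = (+) Na ` {..<Nb}" by (simp add: L_def shift)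
    moreover have "{..<Na + Nb} - (+) Na ` {..<Nb} = {..<Na}" unfolding split by auto
    ultimately show ?thesis by (simp add: Vb Va Ua Ub)
  qed
  have e3: "?C (Na + n) = ?Cb n \<and> ?D (Na + n) = ?Db n \<union> verts_of a" if n: "0 < n" "n < Nb" for n
  proof -
    have "L (Na + n) = (+) Na ` Lb n" using n by (simp add: L_def)
    moreover have "{..<Na + Nb} - (+) Na ` Lb n = (+) Na ` ({..<Nb} - Lb n) \<union> {..<Na}"
      unfolding split by auto
    ultimately show ?thesis by (simp add: image_Un Vb Va Ua)
  qed
  have edges_a: "edge_seps a = (\<lambda>n. (?Ca n, ?Da n)) ` {0<..<Na}"
    and edges_b: "edge_seps b = (\<lambda>n. (?Cb n, ?Db n)) ` {0<..<Nb}"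
    using a b by (simp_all add: represents_def)
  have "(\<lambda>n. (?C n, ?D n)) ` {0<..<Na} = (\<lambda>n. (?Ca n, ?Da n \<union> verts_of b)) ` {0<..<Na}"
    by (rule image_cong) (use e1 in auto)
  moreover have "(\<lambda>n. (?C n, ?D n)) ` (+) Na ` {0<..<Nb} = (\<lambda>n. (?Cb n, ?Db n \<union> verts_of a)) ` {0<..<Nb}"
    unfolding image_image by (rule image_cong) (use e3 in auto)
  ultimately have edges: "edge_seps (Attach a b) = (\<lambda>n. (?C n, ?D n)) ` {0<..<Na + Nb}"
    unfolding split_pos image_Un edge_seps.simps edges_a edges_b image_image using e2 by simp
  have adh: "?C n \<inter> ?D n \<subseteq> V n \<inter> V (p n)" if coh: "coherent (Attach a b)" and n: "n \<in> {0<..<Na + Nb}" for n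
  proof -
    have coh': "coherent a" "coherent b" "verts_of a \<inter> verts_of b \<subseteq> root_part a \<inter> root_part b"
      using coh by auto
    have n': "0 < n" "n < Na + Nb" using n by auto
    show ?thesis
    proof (rule cases[OF n'(2)])
      assume na: "n < Na"
      have ed: "(?Ca n, ?Da n) \<in> edge_seps a" unfolding edges_a
        by (rule rev_image_eqI[of n]) (use n'(1) na in simp_all)
      \<comment> \<open>Coherence puts vertices shared with \<open>b\<close> into the root part of
        \<open>a\<close>, hence already on the root side: adding \<open>b\<close> there does not
        enlarge the separator.\<close>
      have "?Ca n \<inter> verts_of b \<subseteq> ?Da n"
        using coh'(3) edge_seps_Un[OF ed] root_part_subset_edge_sep[OF ed] by blast
      then have "?C n \<inter> ?D n \<subseteq> ?Ca n \<inter> ?Da n" using e1[OF n'(1) na] by blast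
      also have "\<dots> \<subseteq> Va n \<inter> Va (pa n)" using a coh'(1) n'(1) na by (simp add: represents_def)
      also have "\<dots> = V n \<inter> V (p n)" using A.parent_less[OF n'(1) na] na by (simp add: V_def p_def)
      finally show ?thesis .
    next
      assume n: "n = Na"
      have "V n = root_part b" "V (p n) = root_part a"
        using a b n pos by (simp_all add: represents_def V_def p_def)
      with n e2 coh'(3) show ?thesis by blast
    next
      fix j assume j: "0 < j" "j < Nb" "n = Na + j"
      have ed: "(?Cb j, ?Db j) \<in> edge_seps b" unfolding edges_b
        by (rule rev_image_eqI[of j]) (use j in simp_all)
      have "?Cb j \<inter> verts_of a \<subseteq> ?Db j"
        using coh'(3) edge_seps_Un[OF ed] root_part_subset_edge_sep[OF ed] by blast
      then have "?C n \<inter> ?D n \<subseteq> ?Cb j \<inter> ?Db j" using e3[OF j(1,2)] j(3) by blast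
      also have "\<dots> \<subseteq> Vb j \<inter> Vb (pb j)" using b coh'(2) j by (simp add: represents_def)
      also have "\<dots> = V n \<inter> V (p n)" using j by (simp add: V_def p_def)
      finally show ?thesis .
    qed
  qed
  show ?thesis
    unfolding represents_def using array root parts edges adh by blast
qed

lemma exists_represents: "\<exists>N p L V. represents N p L V x"
proof (induction x)
  case (Single X)
  \<comment> \<open>A single vertex has no parent edge, so \<open>id\<close> and the empty
    descendant sets are mere placeholders.\<close>
  have "represents 1 id (\<lambda>_. {}) (\<lambda>_. X) (Single X)"
    by (auto simp: represents_def parent_array_def)
  then show ?case by blast
next
  case (Attach a b)
  then obtain Na pa La Va Nb pb Lb Vb
    where "represents Na pa La Va a" "represents Nb pb Lb Vb b" by blast
  from represents_Attach[OF this] show ?case by blast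
qed

lemma exists_tree_decomposition:
  assumes "decomposes G x"
  obtains T :: "(nat, nat \<times> nat) pre_digraph" and V where
    "tree_decomposition G T V" "V ` verts T = parts x" "finite (verts T)"
    "\<And>t u. t \<rightarrow>\<^bsub>T\<^esub> u \<Longrightarrow> edge_separation T V t u \<in> edge_seps x \<union> prod.swap ` edge_seps x"
    "\<And>t u. t \<rightarrow>\<^bsub>T\<^esub> u \<Longrightarrow> t \<in> verts T \<and> u \<in> verts T \<and>
       V t \<subseteq> fst (edge_separation T V t u) \<and> V u \<subseteq> snd (edge_separation T V t u)"
    "\<And>s. s \<in> edge_seps x \<Longrightarrow> \<exists>t u. t \<rightarrow>\<^bsub>T\<^esub> u \<and> edge_separation T V t u = s"
proof -
  obtain N p L V where r: "represents N p L V x" using exists_represents by blast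
  interpret parent_array N p L using r by (simp add: represents_def)
  have x: "coherent x" "verts_of x = verts G" using assms by (auto simp: decomposes_def)
  have parts: "V ` {..<N} = parts x" and edges:
    "edge_seps x = (\<lambda>n. (\<Union>(V ` L n), \<Union>(V ` ({..<N} - L n)))) ` {0<..<N}"
    and adh: "\<And>n. 0 < n \<Longrightarrow> n < N \<Longrightarrow> \<Union>(V ` L n) \<inter> \<Union>(V ` ({..<N} - L n)) \<subseteq> V n \<inter> V (p n)"
    using r x by (auto simp: represents_def)
  have arc: "\<exists>n. 0 < n \<and> n < N \<and> (t = n \<and> u = p n \<or> t = p n \<and> u = n)" if "t \<rightarrow>\<^bsub>T\<^esub> u" for t u
  proof -
    have "(t, u) \<in> arcs T" using that by (simp add: arcs_ends_parent_graph)
    then show ?thesis by (rule parent_graph_arcE) auto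
  qed
  have "tree_decomposition G T V"
    unfolding tree_decomposition_def
  proof (intro conjI allI impI ballI)
    show "undirected_tree T" by (rule undirected_tree_T)
    show "\<Union>(V ` verts T) = verts G" using parts Union_parts[of x] x(2) by simp
    show "\<exists>t\<in>verts T. e \<in> arcs (G \<restriction> V t)" if e: "e \<in> arcs G" for e
    proof -
      obtain X where X: "X \<in> parts x" "e \<in> arcs (G \<restriction> X)" using assms e by (rule decomposes_arc)
      then have "X \<in> V ` {..<N}" using parts by simp
      with X(2) show ?thesis by auto
    qed
    show "V t1 \<inter> V t3 \<subseteq> V t2"
      if "pre_digraph.apath T t1 q t3 \<and> t2 \<in> set (pre_digraph.awalk_verts T t1 q)" for t1 t2 t3 q
      using apath_part_subset[of V t1 q t3 t2] adh that by blast
  qed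
  moreover have "V ` verts T = parts x" using parts by simp
  moreover have "finite (verts T)" by simp
  moreover have "edge_separation T V t u \<in> edge_seps x \<union> prod.swap ` edge_seps x" if tu: "t \<rightarrow>\<^bsub>T\<^esub> u" for t u
  proof -
    obtain n where n: "0 < n" "n < N" "t = n \<and> u = p n \<or> t = p n \<and> u = n" using arc[OF tu] by blast
    have "(\<Union>(V ` L n), \<Union>(V ` ({..<N} - L n))) \<in> edge_seps x" unfolding edges using n by auto
    with n(3) show ?thesis by (auto simp: edge_separation_T[OF n(1,2)])
  qed
  moreover have "t \<in> verts T \<and> u \<in> verts T \<and>
       V t \<subseteq> fst (edge_separation T V t u) \<and> V u \<subseteq> snd (edge_separation T V t u)" if tu: "t \<rightarrow>\<^bsub>T\<^esub> u" for t u
  proof -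
    obtain n where n: "0 < n" "n < N" "t = n \<and> u = p n \<or> t = p n \<and> u = n" using arc[OF tu] by blast
    have "p n < N" using parent_less[OF n(1,2)] n(2) by simp
    moreover have "n \<in> L n" "p n \<in> {..<N} - L n"
      using self_desc[OF n(1,2)] parent_not_desc[OF n(1,2)] \<open>p n < N\<close> by auto
    ultimately show ?thesis using n by (auto simp: edge_separation_T[OF n(1,2)])
  qed
  moreover have "\<exists>t u. t \<rightarrow>\<^bsub>T\<^esub> u \<and> edge_separation T V t u = s" if s: "s \<in> edge_seps x" for s
  proof -
    obtain n where n: "0 < n" "n < N" "s = (\<Union>(V ` L n), \<Union>(V ` ({..<N} - L n)))"
      using s unfolding edges by auto
    then have "n \<rightarrow>\<^bsub>T\<^esub> p n" by (auto simp: arcs_ends_parent_graph in_arcs_parent_graph)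
    with n edge_separation_T(1)[OF n(1,2)] show ?thesis by metis
  qed
  ultimately show thesis by (rule that)
qed

section \<open>Tangles and blocks at lean parts\<close>

text \<open>The threshold is \<open>k\<close> for every order: at a lean part one side has at most
  as many vertices of \<open>X\<close> as the separator, hence fewer than \<open>k\<close>.\<close>

definition part_tangle :: "('a, 'b) pre_digraph \<Rightarrow> nat \<Rightarrow> 'a set \<Rightarrow> 'a separation set" where
  "part_tangle G k X = {(A, B). (A, B) \<in> separations_below G k \<and> card (A \<inter> X) < k}"

lemma verts_induced_union3: "verts (induced_union3 G A B C) = A \<union> B \<union> C"
  by (simp add: induced_union3_def Digraph_Component.union_def)

lemma card_cover3_less:
  assumes "finite X" "int (card X) > 3 * int k - 3" "0 < k"
    and "card (A \<inter> X) < k" "card (B \<inter> X) < k" "card (C \<inter> X) < k"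
  shows "\<not> X \<subseteq> A \<union> B \<union> C"
proof
  assume "X \<subseteq> A \<union> B \<union> C"
  then have "X = (A \<inter> X) \<union> (B \<inter> X) \<union> (C \<inter> X)" by blast
  then have "card X \<le> card (A \<inter> X) + card (B \<inter> X) + card (C \<inter> X)"
    by (metis add_le_mono1 card_Un_le order_trans)
  then show False using assms by linarith
qed

text \<open>Three small sides contain at most \<open>3 * (k - 1)\<close> vertices of
  \<open>X\<close>, so they do not cover it. This one fact yields uniqueness of orientation,
  consistency, the tangle axiom and the witness property; leanness supplies an orientation of every
  separation.\<close>

lemma lean_part_tangle:
  assumes fin: "finite (verts G)" and wf: "wf_digraph G" and X: "X \<subseteq> verts G" "lean_part G k X"
    and big: "int (card X) > 3 * int k - 3"
  shows "tangle G k (part_tangle G k X)" "witnesses G (G \<restriction> X) (part_tangle G k X)"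
    "induces G X (part_tangle G k X)"
proof -
  let ?\<tau> = "part_tangle G k X"
  have fX: "finite X" using fin X(1) finite_subset by blast
  \<comment> \<open>For \<open>k = 0\<close> there are no separations to orient, and the conditions
    on elements of the tangle are vacuous.\<close>
  have kpos: "0 < k" if "(A, B) \<in> separations_below G k" for A B
    using that by (auto simp: separations_below_iff)
  have mem: "(A, B) \<in> ?\<tau> \<longleftrightarrow> (A, B) \<in> separations_below G k \<and> card (A \<inter> X) < k" for A B
    by (simp add: part_tangle_def)
  have no_cover: "\<not> X \<subseteq> A1 \<union> A2 \<union> A3"
    if "(A1, B1) \<in> ?\<tau>" "(A2, B2) \<in> ?\<tau>" "(A3, B3) \<in> ?\<tau>" for A1 B1 A2 B2 A3 B3
    using card_cover3_less[OF fX big] kpos that unfolding mem by blast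
  have swap: "(B, A) \<in> separations_below G k" if "(A, B) \<in> separations_below G k" for A B
    using that separations_swap[of A B G] by (auto simp: separations_below_iff Int_commute)
  have cover: "X \<subseteq> A \<union> B" if "(A, B) \<in> separations_below G k" for A B
    using that X(1) separations_Un[of A B G] by (simp add: separations_below_iff)
  have not_both: "\<not> ((A, B) \<in> ?\<tau> \<and> (B, A) \<in> ?\<tau>)" for A B
    using no_cover[of A B B A B A] cover[of A B] mem by auto
  have total: "(A, B) \<in> ?\<tau> \<or> (B, A) \<in> ?\<tau>" if AB: "(A, B) \<in> separations_below G k" for A B
  proof -
    have "card (A \<inter> B) < k" using AB by (simp add: separations_below_iff)
    moreover have "card (A \<inter> X) \<le> card (A \<inter> B) \<or> card (B \<inter> X) \<le> card (A \<inter> B)"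
      using X(2) AB by (simp add: lean_part_def)
    ultimately show ?thesis using AB swap[OF AB] by (auto simp: mem)
  qed
  have iff: "(A, B) \<in> ?\<tau> \<longleftrightarrow> (B, A) \<notin> ?\<tau>" if "(A, B) \<in> separations_below G k" for A B
    using total[OF that] not_both[of A B] by blast
  have "orientation G k ?\<tau>"
    unfolding orientation_def
  proof (intro conjI ballI impI)
    show "?\<tau> \<subseteq> separations_below G k" by (auto simp: part_tangle_def)
    fix s assume s: "s \<in> separations_below G k"
    obtain A B where AB: "s = (A, B)" by (cases s)
    show "s \<in> ?\<tau>" if "degenerate s"
    proof -
      have "B = A" using that unfolding AB degenerate_def by (metis prod.inject swap_simp)
      with iff[of A B] s show ?thesis unfolding AB by blast
    qed
    show "s \<in> ?\<tau> \<longleftrightarrow> prod.swap s \<notin> ?\<tau>" if "\<not> degenerate s"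
      using iff[of A B] s AB by simp
  qed
  moreover have "consistent ?\<tau>"
    unfolding consistent_def
  proof (rule notI, elim exE conjE)
    fix r s
    assume "sep_less r s" "prod.swap r \<in> ?\<tau>" "s \<in> ?\<tau>"
    moreover obtain A B C D where "r = (A, B)" "s = (C, D)" by (cases r, cases s)
    ultimately have "A \<subseteq> C" and BA: "(B, A) \<in> ?\<tau>" and CD: "(C, D) \<in> ?\<tau>"
      by (simp_all add: sep_less_def sep_le_def)
    moreover have "X \<subseteq> B \<union> A" using cover BA by (simp add: mem)
    ultimately have "X \<subseteq> B \<union> C \<union> C" by blast
    then show False using no_cover[of B A C D C D] BA CD by simp
  qed
  moreover have "\<not> \<sigma> \<subseteq> ?\<tau>" if triple: "\<sigma> \<in> tangle_triples G k" for \<sigma>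
  proof
    assume sub: "\<sigma> \<subseteq> ?\<tau>"
    obtain A1 B1 A2 B2 A3 B3 where \<sigma>: "\<sigma> = {(A1, B1), (A2, B2), (A3, B3)}"
      and "induced_union3 G A1 A2 A3 = G"
      using triple unfolding tangle_triples_def mem_Collect_eq by (elim exE conjE) (rule that)
    then have "verts G = A1 \<union> A2 \<union> A3" using verts_induced_union3[of G A1 A2 A3] by simp
    moreover have "\<not> X \<subseteq> A1 \<union> A2 \<union> A3" using no_cover sub unfolding \<sigma> by blast
    ultimately show False using X(1) by simp
  qed
  ultimately show "tangle G k ?\<tau>" by (simp add: tangle_def)
  have "subgraph (G \<restriction> X) G"
    using X(1) wf unfolding subgraph_def compatible_def
    by (auto simp: wf_digraph_def)
  moreover have "induced_union3 G (A1 \<inter> X) (A2 \<inter> X) (A3 \<inter> X) \<noteq> G \<restriction> X"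
    if "{(A1, B1), (A2, B2), (A3, B3)} \<subseteq> ?\<tau>" for A1 B1 A2 B2 A3 B3
  proof
    assume "induced_union3 G (A1 \<inter> X) (A2 \<inter> X) (A3 \<inter> X) = G \<restriction> X"
    then have "X = A1 \<inter> X \<union> A2 \<inter> X \<union> A3 \<inter> X"
      using verts_induced_union3[of G "A1 \<inter> X" "A2 \<inter> X" "A3 \<inter> X"] by simp
    then have "X \<subseteq> A1 \<union> A2 \<union> A3" by blast
    moreover have "\<not> X \<subseteq> A1 \<union> A2 \<union> A3" using no_cover that by blast
    ultimately show False by blast
  qed
  ultimately show "witnesses G (G \<restriction> X) ?\<tau>" by (simp add: witnesses_def)
  have "card (A \<inter> X) < card (B \<inter> X)" if AB: "(A, B) \<in> ?\<tau>" for A B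
  proof -
    have "(B, A) \<notin> ?\<tau>" using AB not_both by blast
    moreover have "(A, B) \<in> separations_below G k" using AB by (simp add: mem)
    ultimately have "k \<le> card (B \<inter> X)" using swap mem not_less by blast
    with AB show ?thesis by (simp add: mem)
  qed
  then show "induces G X ?\<tau>" using X(1) by (auto simp: induces_def)
qed

section \<open>Blocks and the parts that contain them\<close>

lemma inseparable_side:
  assumes "inseparable G k b" "b \<subseteq> verts G" "(C, D) \<in> separations_below G k"
  shows "b \<subseteq> C \<or> b \<subseteq> D"
proof (rule ccontr)
  assume "\<not> (b \<subseteq> C \<or> b \<subseteq> D)"
  then obtain u v where uv: "u \<in> b" "u \<notin> D" "v \<in> b" "v \<notin> C" by blast
  have CD: "(C, D) \<in> separations G" "card (C \<inter> D) < k" using assms(3) by (auto simp: separations_below_iff)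
  have V: "C \<union> D = verts G" by (rule separations_Un[OF CD(1)])
  let ?H = "G \<restriction> (verts G - C \<inter> D)"
  \<comment> \<open>Every arc lies inside \<open>C\<close> or inside \<open>D\<close>, so a walk
    avoiding \<open>C \<inter> D\<close> cannot leave \<open>C - D\<close>. Thus
    \<open>C \<inter> D\<close> would separate \<open>u\<close> from \<open>v\<close>.\<close>
  have "w \<in> C - D" if "u \<rightarrow>\<^sup>*\<^bsub>?H\<^esub> w" for w
    using reachable_rtranclI[OF that]
  proof (induction rule: rtrancl_induct)
    case base
    then show ?case using uv assms(2) V by blast
  next
    case (step y z)
    obtain e where e: "e \<in> arcs ?H" "tail ?H e = y" "head ?H e = z" using step(2) by (rule reachableE)
    then have "e \<in> arcs G" "tail G e = y" "head G e = z" "z \<notin> C \<inter> D"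
      by (simp_all add: induce_subgraph_def)
    moreover have "e \<in> arcs (G \<restriction> C) \<union> arcs (G \<restriction> D)"
      using CD(1) \<open>e \<in> arcs G\<close> by (auto simp: separations_def)
    ultimately show ?case using step.IH by (auto simp: induce_subgraph_def)
  qed
  then have "separates G (C \<inter> D) u v"
    using uv assms(2) V unfolding separates_def by blast
  moreover have "C \<inter> D \<subseteq> verts G" using V by blast
  ultimately show False using assms(1) uv CD(2) unfolding inseparable_def by blast
qed

lemma separable_block_is_part:
  assumes fin: "finite (verts G)" and x: "decomposes G x" "adhesion_below x k"
    and lean: "\<And>X. X \<in> parts x \<Longrightarrow> k \<le> card X \<Longrightarrow> lean_part G k X"
    and b: "separable_block G k b"
  shows "b \<in> parts x"
proof -
  obtain \<sigma> where ins: "b \<subseteq> verts G" "k \<le> card b" "inseparable G k b"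
    and star: "sep_star G \<sigma>" "\<sigma> \<subseteq> separations_below G k" "b = star_interior G \<sigma>"
    using b unfolding separable_block_def block_def by blast
  have star_le: "sep_le r (prod.swap s)" if "r \<in> \<sigma>" "s \<in> \<sigma>" "r \<noteq> s" for r s
    using star(1) that by (simp add: sep_star_def)
  have below: "(C, D) \<in> separations_below G k" if "(C, D) \<in> edge_seps x" for C D
    using decomposes_edge_seps[OF x(1) that] x(2) that by (simp add: separations_below_iff adhesion_below_def)
  obtain y where y: "tree_equiv y x" "edge_seps y \<subseteq> {(C, D). b \<subseteq> D}"
  proof (rule exists_sink[of x "{(C, D). b \<subseteq> D}"])
    show "(C, D) \<in> {(C, D). b \<subseteq> D} \<or> (D, C) \<in> {(C, D). b \<subseteq> D}" if "(C, D) \<in> edge_seps x" for C D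
      using inseparable_side[OF ins(3,1) below[OF that]] by auto
  qed (use that in blast)+
  let ?R = "root_part y"
  have yv: "verts_of y = verts G" "coherent y" "parts y = parts x"
    using y(1) x(1) by (auto simp: decomposes_def tree_equiv_def)
  have R: "?R \<in> parts x" "?R \<subseteq> verts G"
    using root_part_in_parts[of y] root_part_subset[of y] yv by simp_all
  then have fR: "finite ?R" using fin finite_subset by blast
  have bR: "b \<subseteq> ?R"
    using ins(1) y(2) yv by (intro subsetI in_root_partI[OF yv(2)]) auto
  have "lean_part G k ?R" using lean[OF R(1)] card_mono[OF fR bR] ins(2) by simp
  have "?R \<subseteq> B" if AB: "(A, B) \<in> \<sigma>" for A B
  proof -
    have S: "(A, B) \<in> separations_below G k" using star(2) AB by blast
    then have V: "A \<union> B = verts G" and k: "card (A \<inter> B) < k"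
      using separations_Un[of A B G] by (auto simp: separations_below_iff)
    \<comment> \<open>Another star element points towards \<open>(A, B)\<close>, so all of
      \<open>A\<close> lies on its second side. The separator of \<open>(A, B)\<close> is therefore
      contained in the interior \<open>b\<close>.\<close>
    have "A \<inter> B \<subseteq> snd s" if "s \<in> \<sigma>" for s
    proof (cases "s = (A, B)")
      case False
      then have "sep_le (A, B) (prod.swap s)" using star_le[OF AB that] by simp
      then show ?thesis by (auto simp: sep_le_def)
    qed simp
    then have AB_b: "A \<inter> B \<subseteq> b" using V star(3) unfolding star_interior_def by blast
    have "b \<subseteq> B" using star(3) AB unfolding star_interior_def by force
    then have "card b \<le> card (B \<inter> ?R)" using bR fR by (intro card_mono) auto
    \<comment> \<open>The \<open>B\<close> side contains the block, with at least \<open>k\<close>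
      vertices, so leanness can only bound the \<open>A\<close> side. Equality with the separator
      follows, and no vertex of the root part lies outside \<open>B\<close>.\<close>
    then have "card (A \<inter> ?R) \<le> card (A \<inter> B)"
      using \<open>lean_part G k ?R\<close> S ins(2) k unfolding lean_part_def by fastforce
    moreover have "A \<inter> B \<subseteq> A \<inter> ?R" using AB_b bR by blast
    ultimately have "A \<inter> B = A \<inter> ?R" using fR by (intro card_seteq) auto
    then show ?thesis using V R(2) by blast
  qed
  then have "?R \<subseteq> b" using R(2) star(3) unfolding star_interior_def by fastforce
  with bR R(1) show ?thesis by (simp add: subset_antisym)
qed

section \<open>Assembly of the tree-decomposition\<close>

theorem theorem4p7:
  fixes G :: "('a, 'b) pre_digraph" and k :: nat
  assumes "Digraph.graph G"
  shows "\<exists>(T :: (nat, nat \<times> nat) pre_digraph) (V :: nat \<Rightarrow> 'a set).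
    tree_decomposition G T V \<and> adhesion T V < int k \<and>
    td_efficiently_distinguishes T V {P. profile G k P \<and> regular P} \<and>
    (\<forall>t\<in>verts T. int (card (V t)) > 3 * int k - 3 \<longrightarrow>
       (\<exists>\<tau>. tangle G k \<tau> \<and> home T V t \<tau> \<and> witnesses G (G \<restriction> V t) \<tau> \<and> induces G (V t) \<tau>)) \<and>
    (\<forall>b. separable_block G k b \<longrightarrow> (\<exists>t\<in>verts T. V t = b))"
proof -
  interpret G: Digraph.graph G by (rule assms)
  have fin: "finite (verts G)" and wf: "wf_digraph G"
    by (rule G.finite_verts) (rule G.wf_digraph)
  obtain x where x: "decomposes G x" "adhesion_below x k"
    and dist: "\<And>P Q. regular_profile G k P \<Longrightarrow> regular_profile G k Q \<Longrightarrow>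
      distinguishable_below k P Q \<Longrightarrow> tree_distinguishes x P Q"
    and lean: "\<And>X. X \<in> parts x \<Longrightarrow> k \<le> card X \<Longrightarrow> lean_part G k X"
    using exists_lean_tree[OF fin wf, of k] by metis
  obtain T :: "(nat, nat \<times> nat) pre_digraph" and V where
    td: "tree_decomposition G T V" and parts: "V ` verts T = parts x" and finT: "finite (verts T)"
    and edge: "\<And>t u. t \<rightarrow>\<^bsub>T\<^esub> u \<Longrightarrow> edge_separation T V t u \<in> edge_seps x \<union> prod.swap ` edge_seps x"
    and sides: "\<And>t u. t \<rightarrow>\<^bsub>T\<^esub> u \<Longrightarrow> t \<in> verts T \<and> u \<in> verts T \<and>
       V t \<subseteq> fst (edge_separation T V t u) \<and> V u \<subseteq> snd (edge_separation T V t u)"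
    and edge': "\<And>s. s \<in> edge_seps x \<Longrightarrow> \<exists>t u. t \<rightarrow>\<^bsub>T\<^esub> u \<and> edge_separation T V t u = s"
    by (rule exists_tree_decomposition[OF x(1)]) (rule that)
  have part: "V t \<in> parts x" "V t \<subseteq> verts G" if "t \<in> verts T" for t
    using that parts Union_parts[of x] x(1) by (auto simp: decomposes_def)
  have below: "edge_separation T V t u \<in> separations_below G k" if tu: "t \<rightarrow>\<^bsub>T\<^esub> u" for t u
  proof -
    obtain C D where CD: "edge_separation T V t u = (C, D)" by fastforce
    then have "(C, D) \<in> edge_seps x \<or> (D, C) \<in> edge_seps x" using edge[OF tu] by auto
    then show ?thesis
      using decomposes_edge_seps[OF x(1)] x(2) separations_swap[of D C G]
      unfolding CD separations_below_iff adhesion_below_def by (metis Int_commute)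
  qed
  \<comment> \<open>Both sets lie in the separator of the edge. The first bound gives the adhesion;
    the second puts the edges directed to a part into its tangle.\<close>
  have card_edge: "card (V t \<inter> V u) < k" "card (fst (edge_separation T V t u) \<inter> V u) < k"
    if tu: "t \<rightarrow>\<^bsub>T\<^esub> u" for t u
  proof -
    obtain C D where CD: "edge_separation T V t u = (C, D)" by fastforce
    have lt: "card (C \<inter> D) < k" and "C \<union> D = verts G"
      using below[OF tu] separations_Un[of C D G] by (auto simp: CD separations_below_iff)
    then have "finite (C \<inter> D)" using fin by (auto intro: finite_subset)
    moreover have "V t \<inter> V u \<subseteq> C \<inter> D" "C \<inter> V u \<subseteq> C \<inter> D" using sides[OF tu] by (auto simp: CD)
    ultimately have "card (V t \<inter> V u) \<le> card (C \<inter> D)" "card (C \<inter> V u) \<le> card (C \<inter> D)"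
      by (auto intro: card_mono)
    with lt show "card (V t \<inter> V u) < k" "card (fst (edge_separation T V t u) \<inter> V u) < k"
      by (auto simp: CD)
  qed
  have "adhesion T V < int k"
  proof -
    let ?S = "{int (card (V t \<inter> V t')) | t t'. t \<rightarrow>\<^bsub>T\<^esub> t'}"
    have "?S \<subseteq> (\<lambda>(t, t'). int (card (V t \<inter> V t'))) ` (verts T \<times> verts T)"
      using sides by fastforce
    then have "finite ?S" using finT by (meson finite_SigmaI finite_imageI finite_subset)
    \<comment> \<open>The inserted value -1 keeps the maximum defined on a one-vertex tree, and it
      is below \<open>k\<close> even for \<open>k = 0\<close>.\<close>
    then show ?thesis
      unfolding adhesion_def using card_edge(1) by (subst Max_less_iff) auto
  qed
  moreover have "td_efficiently_distinguishes T V {P. profile G k P \<and> regular P}"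
    unfolding td_efficiently_distinguishes_def
  proof (intro ballI impI)
    fix P Q assume "P \<in> {P. profile G k P \<and> regular P}" "Q \<in> {P. profile G k P \<and> regular P}" and ne: "P \<noteq> Q"
    then have P: "regular_profile G k P" and Q: "regular_profile G k Q"
      by (simp_all add: regular_profile_def)
    have diff: "distinguishable_below k P Q"
      if P: "regular_profile G k P" and Q: "regular_profile G k Q" and s: "(A, B) \<in> P" "(A, B) \<notin> Q" for A B P Q
    proof -
      have S: "(A, B) \<in> separations_below G k" using s(1) regular_profile_subset[OF P] by blast
      then have "(B, A) \<in> Q" using regular_profile_total[OF Q] s(2) by blast
      then have "distinguishes (A, B) P Q" using s(1) by (simp add: distinguishes_regular[OF P Q])
      with S show ?thesis
        unfolding distinguishable_below_def separations_below_iff sep_order_def by fastforce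
    qed
    \<comment> \<open>A separation belonging to only one of two regular profiles distinguishes them,
      because the other contains its inverse; either inclusion may be the one that fails.\<close>
    have "distinguishable_below k P Q"
    proof (cases "P \<subseteq> Q")
      case True
      then obtain A B where "(A, B) \<in> Q" "(A, B) \<notin> P" using ne by auto
      from diff[OF Q P this] show ?thesis
        unfolding distinguishable_below_def distinguishes_def by metis
    next
      case False
      then obtain A B where "(A, B) \<in> P" "(A, B) \<notin> Q" by auto
      from diff[OF P Q this] show ?thesis .
    qed
    from dist[OF P Q this] obtain s where s: "s \<in> edge_seps x" "efficiently_distinguishes s P Q"
      unfolding tree_distinguishes_def by blast
    with edge'[OF s(1)]
    show "\<exists>t1 t2. t1 \<rightarrow>\<^bsub>T\<^esub> t2 \<and> efficiently_distinguishes (edge_separation T V t1 t2) P Q"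
      by metis
  qed
  moreover have "\<exists>\<tau>. tangle G k \<tau> \<and> home T V t \<tau> \<and> witnesses G (G \<restriction> V t) \<tau> \<and> induces G (V t) \<tau>"
    if t: "t \<in> verts T" and big: "int (card (V t)) > 3 * int k - 3" for t
  proof -
    \<comment> \<open>The part has at least \<open>3k - 2\<close> vertices, which is at least
      \<open>k\<close> for positive \<open>k\<close>; for \<open>k = 0\<close> the bound is
      trivial.\<close>
    have "k \<le> card (V t)" using big by linarith
    then have "lean_part G k (V t)" using lean part(1)[OF t] by blast
    note tangle = lean_part_tangle[OF fin wf part(2)[OF t] this big]
    have "edge_separation T V u t \<in> part_tangle G k (V t)" if ut: "u \<rightarrow>\<^bsub>T\<^esub> t" for u
      using below[OF ut] card_edge(2)[OF ut] by (simp add: part_tangle_def case_prod_unfold)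
    then have "home T V t (part_tangle G k (V t))"
      unfolding home_def part_star_def by blast
    with tangle show ?thesis by blast
  qed
  moreover have "\<exists>t\<in>verts T. V t = b" if "separable_block G k b" for b
  proof -
    have "b \<in> V ` verts T"
      unfolding parts by (rule separable_block_is_part[OF fin x lean that])
    then show ?thesis by blast
  qed
  ultimately show ?thesis using td by blast
qed

end
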